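(* Let $d\ge 1$ be an integer, $T>0$, and let $\mu$ be a Borel probability measure on $\mathbb{R}^d$ with density $\rho$ (with respect to Lebesgue measure). Assume: (i) $\rho$ is positive on $\mathbb{R}^d$ and $\int_{\mathbb{R}^d}\rho(y)\left(|y|^2+\log\rho(y)\right)dy<\infty$; (ii) the function $\log\varphi$ is Lipschitz continuous on $\mathbb{R}^d$, where $\varphi(y)=\rho(y)/G_T(y)$ and $G_T(y)=(2\pi T)^{-d/2}e^{-|y|^2/(2T)}$ for $y\in\mathbb{R}^d$. For each $n\in\mathbb{N}$ let $\{Y_i\}_{i=0}^n$ be the Euler-Maruyama scheme $$Y_0=0,\qquad Y_{i+1}=Y_i+b(t_i,Y_i)\frac{T}{n}+\sqrt{\frac{T}{n}}\,Z_{i+1},\quad i=0,1,\ldots,n-1,$$ where $t_i=iT/n$, $Z_1,\ldots,Z_n$ are i.i.d. $d$-dimensional standard normal random vectors on $(\Omega,\mathcal{F},\mathbb{P})$, and $$b(t,y)=\nabla\log \mathbb{E}[\varphi(y+\sqrt{T-t}\,Z)]=\frac{\nabla\mathbb{E}[\varphi(y+\sqrt{T-t}\,Z)]}{\mathbb{E}[\varphi(y+\sqrt{T-t}\,Z)]},\quad (t,y)\in[0,T)\times\mathbb{R}^d,$$ with $Z$ a $d$-dimensional standard normal random vector and $\nabla$ the gradient in $y$. Then the distribution of $Y_n$ under $\mathbb{P}$ converges weakly to $\mu$ as $n\to\infty$.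
   Context: $(\Omega,\mathcal{F},\mathbb{P})$ is an atomless and complete probability space, and $\mathbb{E}$ denotes expectation with respect to $\mathbb{P}$. $|\cdot|$ is the Euclidean norm on $\mathbb{R}^d$. The function $G_T(y)=p_T(0,y)$, where $p_s(x,y)=(2\pi s)^{-d/2}e^{-|x-y|^2/(2s)}$ is the transition density of $d$-dimensional standard Brownian motion. For $t<T$, $\mathbb{E}[\varphi(y+\sqrt{T-t}\,Z)]=\int_{\mathbb{R}^d}\varphi(z)p_{T-t}(y,z)\,dz$. The scheme is the Euler-Maruyama discretization, with step $T/n$, of the stochastic differential equation $dX_t=b(t,X_t)\,dt+dB_t$, $X_0=0$, on $[0,T]$, where $B$ is a $d$-dimensional standard Brownian motion (the Schrödinger-Föllmer diffusion). *)

theory Defs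
  imports "HOL-Probability.Probability"
begin

text \<open>The density \<open>p\<^sub>s(x,y)\<close> of the Gaussian law with mean \<open>x\<close> and covariance \<open>s\<close> times the
  identity, for \<open>s > 0\<close>.\<close>

definition heat_kernel :: "real \<Rightarrow> 'a::euclidean_space \<Rightarrow> 'a \<Rightarrow> real" where
  "heat_kernel s x y =
     (2 * pi * s) powr (- (real DIM('a) / 2)) * exp (- (norm (x - y))\<^sup>2 / (2 * s))"

definition std_normal_vector :: "'w measure \<Rightarrow> ('w \<Rightarrow> 'a::euclidean_space) \<Rightarrow> bool" where
  "std_normal_vector M Z \<longleftrightarrow> distributed M lborel Z (\<lambda>z. ennreal (heat_kernel 1 0 z))"

definition atomless :: "'w measure \<Rightarrow> bool" where
  "atomless M \<longleftrightarrow>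
     (\<forall>A\<in>sets M. emeasure M A > 0 \<longrightarrow>
        (\<exists>B\<in>sets M. B \<subseteq> A \<and> 0 < emeasure M B \<and> emeasure M B < emeasure M A))"

text \<open>The library's \<open>weak_conv_m\<close> is defined through distribution functions and only covers
  measures on the real line, so weak convergence is defined here by testing against bounded
  continuous functions.\<close>

definition weakly_converges ::
    "(nat \<Rightarrow> 'a::topological_space measure) \<Rightarrow> 'a measure \<Rightarrow> bool" where
  "weakly_converges \<mu>s \<mu> \<longleftrightarrow>
     (\<forall>f :: 'a \<Rightarrow> real. continuous_on UNIV f \<and> bounded (range f) \<longrightarrow>
        (\<lambda>n. \<integral>x. f x \<partial>(\<mu>s n)) \<longlonglongrightarrow> (\<integral>x. f x \<partial>\<mu>))"

text \<open>The gradient; unspecified where the function is not differentiable.\<close>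

definition grad :: "('a::real_inner \<Rightarrow> real) \<Rightarrow> 'a \<Rightarrow> 'a" where
  "grad f x = (THE D. GDERIV f x :> D)"

definition phi :: "real \<Rightarrow> ('a::euclidean_space \<Rightarrow> real) \<Rightarrow> 'a \<Rightarrow> real" where
  "phi T \<rho> y = \<rho> y / heat_kernel T 0 y"

text \<open>\<open>Z\<close> is meant to be a standard normal vector on \<open>M\<close>; the value then depends only on its law.\<close>

definition sf_drift ::
    "'w measure \<Rightarrow> ('w \<Rightarrow> 'a::euclidean_space) \<Rightarrow> real \<Rightarrow> ('a \<Rightarrow> real) \<Rightarrow> real \<Rightarrow> 'a \<Rightarrow> 'a" where
  "sf_drift M Z T \<rho> t =
     grad (\<lambda>y. ln (\<integral>\<omega>. phi T \<rho> (y + sqrt (T - t) *\<^sub>R Z \<omega>) \<partial>M))"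

primrec euler_maruyama ::
    "(real \<Rightarrow> 'a::real_vector \<Rightarrow> 'a) \<Rightarrow> real \<Rightarrow> nat \<Rightarrow> (nat \<Rightarrow> 'w \<Rightarrow> 'a) \<Rightarrow> nat \<Rightarrow> 'w \<Rightarrow> 'a" where
  "euler_maruyama b T n Z 0 \<omega> = 0"
| "euler_maruyama b T n Z (Suc i) \<omega> =
     euler_maruyama b T n Z i \<omega>
       + (T / real n) *\<^sub>R b (real i * T / real n) (euler_maruyama b T n Z i \<omega>)
       + sqrt (T / real n) *\<^sub>R Z (Suc i) \<omega>"

lemma GDERIV_unique:
  assumes "GDERIV f x :> D" "GDERIV f x :> E"
  shows "D = E"
proof -
  have "(\<lambda>h. h \<bullet> D) = (\<lambda>h. h \<bullet> E)"
    using assms unfolding gderiv_def by (rule has_derivative_unique)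
  then have "h \<bullet> D = h \<bullet> E" for h by meson
  then have "(D - E) \<bullet> (D - E) = 0" by (simp add: inner_diff_right)
  then show ?thesis by simp
qed

lemma grad_eq: "GDERIV f x :> D \<Longrightarrow> grad f x = D"
  unfolding grad_def by (blast intro: GDERIV_unique)

text \<open>The second expression for the drift, \<open>\<nabla> log u = \<nabla> u / u\<close>.\<close>

lemma grad_ln:
  assumes "GDERIV u x :> D" "u x > 0"
  shows "grad (\<lambda>y. ln (u y)) x = grad u x /\<^sub>R u x"
proof -
  have "DERIV ln (u x) :> inverse (u x)"
    using assms(2) by (rule DERIV_ln)
  then have "GDERIV (\<lambda>y. ln (u y)) x :> inverse (u x) *\<^sub>R D"
    using assms(1) by (rule GDERIV_DERIV_compose[rotated])
  then show ?thesis
    using grad_eq[OF assms(1)] by (simp add: grad_eq)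
qed

end

theory Submission
  imports Defs "HOL-Real_Asymp.Real_Asymp"
begin

text \<open>Write \<open>\<phi> = \<rho> / G\<^sub>T\<close>, let \<open>u(t, y)\<close> be the expectation of \<open>\<phi>(y + sqrt (T - t) Z)\<close>, and let
  \<open>h = T / n\<close>. The proof compares the Euler chain with an exact chain in discrete time, without
  stochastic calculus.

  For a bounded measurable \<open>f\<close>, let \<open>U(t, y)\<close> be the heat average of \<open>f * \<phi>\<close> at \<open>y\<close> over the remaining
  time \<open>T - t\<close>, divided by \<open>u(t, y)\<close>. Then \<open>U(T, y) = f y\<close>, and \<open>U(0, 0)\<close> is the integral of \<open>f\<close> with
  respect to \<open>\<mu>\<close>, because \<open>G\<^sub>T\<close> is the density of \<open>sqrt T Z\<close>. Hence it suffices to show that the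
  expectation of \<open>U\<close> hardly changes along the Euler chain.

  Consider the step from \<open>y\<close> at the time \<open>t\<close> to the time \<open>t' = t + h\<close>. By the semigroup law, \<open>U(t, y)\<close>
  is the Gaussian average of \<open>z \<mapsto> U(t', y + sqrt h z)\<close> with the weight \<open>u(t', y + sqrt h z) / u(t, y)\<close>,
  and by the Cameron-Martin formula the Euler step gives the same average with the weight
  \<open>exp (k \<bullet> z - (norm k)\<^sup>2 / 2)\<close>, where \<open>k = sqrt h b(t, y)\<close>. Since \<open>b = \<nabla>u / u\<close>, the two weights agree
  to first order. If \<open>s = T - t'\<close> is positive, they differ by \<open>O(h / sqrt s)\<close>
  (\<open>transition_density_diff_le\<close>): as \<open>ln \<phi>\<close> is Lipschitz, the second derivatives of \<open>u\<close> are of order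
  \<open>u / sqrt s\<close>. Moreover \<open>U(t', y)\<close> is Lipschitz in \<open>y\<close> with a constant of order \<open>1 / sqrt s\<close>
  (\<open>heat_ratio_lipschitz\<close>), so that it varies by \<open>O(sqrt h / sqrt s)\<close> during the step. Both weights have
  mass one, so the two orders multiply, and the error of the step is \<open>O(sqrt h * h / s)\<close> uniformly in
  \<open>y\<close> (\<open>euler_step_error\<close>). In the last step \<open>s = 0\<close>, and the error is \<open>O(sqrt h)\<close>. The times \<open>s\<close> are
  multiples of \<open>h\<close>, so the errors add up to \<open>sqrt h\<close> times a harmonic sum, which is of order
  \<open>ln n / sqrt n\<close> (\<open>euler_maruyama_error\<close>). The bound depends on \<open>f\<close> only through its supremum, so it
  even controls the total variation distance.\<close>

section \<open>The standard Gaussian measure\<close>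

lemma heat_kernel_nonneg [simp]: "heat_kernel s x y \<ge> 0"
  by (simp add: heat_kernel_def)

lemma heat_kernel_pos: "s > 0 \<Longrightarrow> heat_kernel s x y > 0"
  by (simp add: heat_kernel_def)

lemma measurable_heat_kernel [measurable (raw)]:
  assumes [measurable]: "f \<in> borel_measurable N" "g \<in> borel_measurable N"
  shows "(\<lambda>\<omega>. heat_kernel s (f \<omega>) (g \<omega>)) \<in> borel_measurable N"
  unfolding heat_kernel_def by measurable

lemma heat_kernel_eq_prod:
  fixes x y :: "'a::euclidean_space"
  assumes "s > 0"
  shows "heat_kernel s x y = (\<Prod>b\<in>Basis. normal_density (x \<bullet> b) (sqrt s) (y \<bullet> b))"
proof -
  have "(2 * pi * s) powr (- (real DIM('a) / 2)) = (1 / sqrt (2 * pi * s)) ^ DIM('a)"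
  proof -
    have "1 / sqrt (2 * pi * s) = (2 * pi * s) powr (- (1/2))"
      using assms by (simp add: powr_minus powr_half_sqrt divide_simps)
    then show ?thesis
      using assms by (simp add: powr_power)
  qed
  moreover have "(\<Prod>b\<in>Basis. exp (- (y \<bullet> b - x \<bullet> b)\<^sup>2 / (2 * s))) = exp (- (norm (x - y))\<^sup>2 / (2 * s))"
  proof -
    have "(norm (x - y))\<^sup>2 = (\<Sum>b\<in>Basis. (y \<bullet> b - x \<bullet> b)\<^sup>2)"
      unfolding norm_minus_commute[of x] power2_norm_eq_inner
      by (subst euclidean_inner) (simp add: inner_diff_left power2_eq_square)
    then show ?thesis
      by (simp add: sum_negf sum_divide_distrib flip: exp_sum)
  qed
  ultimately show ?thesis
    using assms
    unfolding heat_kernel_def normal_density_def prod.distrib by simp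
qed

lemma nn_integral_heat_kernel:
  fixes x :: "'a::euclidean_space"
  assumes "s > 0"
  shows "(\<integral>\<^sup>+y. ennreal (heat_kernel s x y) \<partial>lborel) = 1"
proof -
  have 1: "(\<integral>\<^sup>+y. ennreal (normal_density m (sqrt s) y) \<partial>lborel) = 1" for m
    using prob_space.emeasure_space_1[OF prob_space_normal_density[of "sqrt s" m]] assms
    by (simp add: emeasure_density)
  have "(\<integral>\<^sup>+y. ennreal (heat_kernel s x y) \<partial>lborel) =
     (\<integral>\<^sup>+y. (\<Prod>b\<in>Basis. ennreal (normal_density (x \<bullet> b) (sqrt s) (y \<bullet> b))) \<partial>lborel)"
    using assms by (simp add: heat_kernel_eq_prod prod_ennreal)
  also have "\<dots> = 1"
    by (subst nn_integral_lborel_prod) (simp_all add: 1)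
  finally show ?thesis .
qed

definition std_gauss :: "'a::euclidean_space measure" where
  "std_gauss = density lborel (\<lambda>z. ennreal (heat_kernel 1 0 z))"

lemma sets_std_gauss [measurable_cong, simp]: "sets std_gauss = sets borel"
  and space_std_gauss [simp]: "space std_gauss = UNIV"
  by (simp_all add: std_gauss_def)

interpretation std_gauss: prob_space "std_gauss :: 'a::euclidean_space measure"
  by standard (simp add: std_gauss_def emeasure_density nn_integral_heat_kernel)

lemma std_normal_vector_distr:
  assumes "std_normal_vector M Z"
  shows "Z \<in> borel_measurable M" "distr M borel Z = std_gauss"
  using assms
  unfolding std_normal_vector_def distributed_def std_gauss_def
  by (auto cong: distr_cong)

lemma nn_integral_affine:
  fixes f :: "'a::euclidean_space \<Rightarrow> ennreal"
  assumes [measurable]: "f \<in> borel_measurable borel" and c: "c > 0"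
  shows "(\<integral>\<^sup>+x. f x \<partial>lborel) = ennreal (c ^ DIM('a)) * (\<integral>\<^sup>+x. f (t + c *\<^sub>R x) \<partial>lborel)"
  using c by (subst lborel_affine[of c t])
     (simp_all add: nn_integral_density nn_integral_distr nn_integral_cmult)

lemma heat_kernel_scale:
  fixes y z :: "'a::euclidean_space"
  assumes "s > 0"
  shows "heat_kernel 1 0 z = sqrt s ^ DIM('a) * heat_kernel s y (y + sqrt s *\<^sub>R z)"
proof -
  have "sqrt s ^ DIM('a) = s powr (real DIM('a) / 2)"
    using assms by (simp add: powr_half_sqrt[symmetric] powr_power)
  then have "sqrt s ^ DIM('a) * (2 * pi * s) powr (- (real DIM('a) / 2)) = (2 * pi) powr (- (real DIM('a) / 2))"
    using assms by (simp add: powr_mult powr_minus field_simps)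
  moreover have "(norm (y - (y + sqrt s *\<^sub>R z)))\<^sup>2 = s * (norm z)\<^sup>2"
    using assms by (simp add: power_mult_distrib)
  ultimately show ?thesis
    using assms unfolding heat_kernel_def by (simp add: mult.assoc[symmetric])
qed

lemma nn_integral_std_gauss_scale:
  fixes f :: "'a::euclidean_space \<Rightarrow> ennreal"
  assumes [measurable]: "f \<in> borel_measurable borel" and s: "s > 0"
  shows "(\<integral>\<^sup>+z. f (y + sqrt s *\<^sub>R z) \<partial>std_gauss) = (\<integral>\<^sup>+x. ennreal (heat_kernel s y x) * f x \<partial>lborel)"
proof -
  have "(\<integral>\<^sup>+x. ennreal (heat_kernel s y x) * f x \<partial>lborel) =
     (\<integral>\<^sup>+z. ennreal (sqrt s ^ DIM('a)) * (ennreal (heat_kernel s y (y + sqrt s *\<^sub>R z)) * f (y + sqrt s *\<^sub>R z)) \<partial>lborel)"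
    using s by (subst nn_integral_affine[where c = "sqrt s" and t = y]) (simp_all add: nn_integral_cmult)
  also have "\<dots> = (\<integral>\<^sup>+z. ennreal (heat_kernel 1 0 z) * f (y + sqrt s *\<^sub>R z) \<partial>lborel)"
    using s by (simp add: heat_kernel_scale[of s _ y] ennreal_mult' mult.assoc)
  also have "\<dots> = (\<integral>\<^sup>+z. f (y + sqrt s *\<^sub>R z) \<partial>std_gauss)"
    by (simp add: std_gauss_def nn_integral_density)
  finally show ?thesis by simp
qed

text \<open>The product of the two kernels is the joint density of a Gaussian walk at the times \<open>a\<close> and
  \<open>a + b\<close>; completing the square in \<open>v\<close> factorises it into the law of the endpoint \<open>u\<close> and the
  bridge law of \<open>v\<close> given \<open>u\<close>, which has mean \<open>a u / (a + b)\<close> and variance \<open>a b / (a + b)\<close>.\<close>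

lemma heat_kernel_mult:
  fixes v u :: "'a::euclidean_space"
  assumes a: "a > 0" and b: "b > 0"
  shows "heat_kernel a 0 v * heat_kernel b v u =
     heat_kernel (a + b) 0 u * heat_kernel (a * b / (a + b)) ((a / (a + b)) *\<^sub>R u) v"
proof -
  have "(2 * pi * a) powr r * (2 * pi * b) powr r = (2 * pi * (a + b)) powr r * (2 * pi * (a * b / (a + b))) powr r" for r
  proof -
    have "(2 * pi * a) * (2 * pi * b) = (2 * pi * (a + b)) * (2 * pi * (a * b / (a + b)))"
      using a b by (simp add: divide_simps)
    then show ?thesis by (simp flip: powr_mult)
  qed
  moreover have "(norm v)\<^sup>2 / (2 * a) + (norm (v - u))\<^sup>2 / (2 * b) =
      (norm u)\<^sup>2 / (2 * (a + b)) + (norm ((a / (a + b)) *\<^sub>R u - v))\<^sup>2 / (2 * (a * b / (a + b)))"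
    (is "?l = ?r")
  proof -
    have ab: "a + b > 0" using a b by simp
    define p q r where "p = v \<bullet> v" and "q = u \<bullet> v" and "r = u \<bullet> u"
    define m where "m = a / (a + b)"
    have m: "a = m * (a + b)" using ab by (simp add: m_def)
    have l: "?l = p / (2 * a) + (p - 2 * q + r) / (2 * b)"
      by (simp add: power2_norm_eq_inner inner_diff inner_commute p_def q_def r_def)
    have "?r = r / (2 * (a + b)) + (m * (m * r) - 2 * (m * q) + p) / (2 * (a * b / (a + b)))"
      by (simp add: power2_norm_eq_inner inner_diff inner_commute p_def q_def r_def flip: m_def)
    also have "\<dots> = ?l"
      unfolding l m_def using a b ab
      by (simp add: divide_simps) (simp add: algebra_simps)
    finally show ?thesis by simp
  qed
  ultimately show ?thesis
    unfolding heat_kernel_def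
    by (simp add: mult.commute mult.left_commute mult.assoc flip: exp_add)
qed

text \<open>Chapman-Kolmogorov: after Tonelli, the bridge factor of \<open>heat_kernel_mult\<close> integrates to one.\<close>

lemma nn_integral_std_gauss_add:
  fixes f :: "'a::euclidean_space \<Rightarrow> ennreal"
  assumes [measurable]: "f \<in> borel_measurable borel" and a: "a > 0" and b: "b > 0"
  shows "(\<integral>\<^sup>+x. \<integral>\<^sup>+y. f (sqrt a *\<^sub>R x + sqrt b *\<^sub>R y) \<partial>std_gauss \<partial>std_gauss) =
     (\<integral>\<^sup>+z. f (sqrt (a + b) *\<^sub>R z) \<partial>std_gauss)"
proof -
  let ?c = "a * b / (a + b)" and ?m = "\<lambda>u::'a. (a / (a + b)) *\<^sub>R u"
  have c: "?c > 0" using a b by simp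
  have "(\<integral>\<^sup>+x. \<integral>\<^sup>+y. f (sqrt a *\<^sub>R x + sqrt b *\<^sub>R y) \<partial>std_gauss \<partial>std_gauss) =
     (\<integral>\<^sup>+x. \<integral>\<^sup>+u. ennreal (heat_kernel b (sqrt a *\<^sub>R x) u) * f u \<partial>lborel \<partial>std_gauss)"
    using b by (simp add: nn_integral_std_gauss_scale)
  also have "\<dots> = (\<integral>\<^sup>+v. ennreal (heat_kernel a 0 v) * (\<integral>\<^sup>+u. ennreal (heat_kernel b v u) * f u \<partial>lborel) \<partial>lborel)"
    using nn_integral_std_gauss_scale[of "\<lambda>v. \<integral>\<^sup>+u. ennreal (heat_kernel b v u) * f u \<partial>lborel" a 0] a by simp
  also have "\<dots> = (\<integral>\<^sup>+v. \<integral>\<^sup>+u. ennreal (heat_kernel a 0 v * heat_kernel b v u) * f u \<partial>lborel \<partial>lborel)"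
    by (simp add: nn_integral_cmult[symmetric] ennreal_mult mult.assoc)
  also have "\<dots> = (\<integral>\<^sup>+u. \<integral>\<^sup>+v. ennreal (heat_kernel a 0 v * heat_kernel b v u) * f u \<partial>lborel \<partial>lborel)"
    by (rule lborel_pair.Fubini'[symmetric]) measurable
  also have "\<dots> = (\<integral>\<^sup>+u. \<integral>\<^sup>+v. ennreal (heat_kernel (a + b) 0 u) * f u * ennreal (heat_kernel ?c (?m u) v) \<partial>lborel \<partial>lborel)"
    using a b by (simp add: heat_kernel_mult ennreal_mult mult_ac)
  also have "\<dots> = (\<integral>\<^sup>+u. ennreal (heat_kernel (a + b) 0 u) * f u \<partial>lborel)"
    using c by (simp add: nn_integral_cmult nn_integral_heat_kernel)
  also have "\<dots> = (\<integral>\<^sup>+z. f (sqrt (a + b) *\<^sub>R z) \<partial>std_gauss)"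
    using a b nn_integral_std_gauss_scale[of f "a + b" 0] by simp
  finally show ?thesis .
qed

interpretation std_gauss2: pair_prob_space "std_gauss :: 'a::euclidean_space measure" "std_gauss :: 'a measure"
  by standard

lemma distr_std_gauss_add:
  assumes "a > 0" "b > 0"
  shows "distr (std_gauss \<Otimes>\<^sub>M std_gauss) borel (\<lambda>(x, y). sqrt a *\<^sub>R x + sqrt b *\<^sub>R y) =
     distr std_gauss (borel :: 'a::euclidean_space measure) (\<lambda>z. sqrt (a + b) *\<^sub>R z)"
proof (rule measure_eqI)
  fix A :: "'a set"
  assume "A \<in> sets (distr (std_gauss \<Otimes>\<^sub>M std_gauss) borel (\<lambda>(x::'a, y). sqrt a *\<^sub>R x + sqrt b *\<^sub>R y))"
  then have [measurable]: "A \<in> sets borel" by simp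
  have "emeasure (distr (std_gauss \<Otimes>\<^sub>M std_gauss) borel (\<lambda>(x::'a, y). sqrt a *\<^sub>R x + sqrt b *\<^sub>R y)) A =
     (\<integral>\<^sup>+p. indicator A (sqrt a *\<^sub>R fst p + sqrt b *\<^sub>R snd p) \<partial>(std_gauss \<Otimes>\<^sub>M std_gauss))"
    using nn_integral_distr[of "\<lambda>(x::'a, y). sqrt a *\<^sub>R x + sqrt b *\<^sub>R y" "std_gauss \<Otimes>\<^sub>M std_gauss" borel "indicator A"]
    by (simp add: split_beta)
  also have "\<dots> = (\<integral>\<^sup>+x. \<integral>\<^sup>+y. indicator A (sqrt a *\<^sub>R x + sqrt b *\<^sub>R y) \<partial>std_gauss \<partial>std_gauss)"
    by (subst std_gauss.nn_integral_fst[symmetric]) simp_all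
  also have "\<dots> = (\<integral>\<^sup>+z. indicator A (sqrt (a + b) *\<^sub>R z) \<partial>std_gauss)"
    using assms by (rule nn_integral_std_gauss_add[rotated]) simp
  also have "\<dots> = emeasure (distr std_gauss borel (\<lambda>z. sqrt (a + b) *\<^sub>R z)) A"
    using nn_integral_distr[of "\<lambda>z::'a. sqrt (a + b) *\<^sub>R z" std_gauss borel "indicator A"] by simp
  finally show "emeasure (distr (std_gauss \<Otimes>\<^sub>M std_gauss) borel (\<lambda>(x::'a, y). sqrt a *\<^sub>R x + sqrt b *\<^sub>R y)) A =
    emeasure (distr std_gauss borel (\<lambda>z. sqrt (a + b) *\<^sub>R z)) A" .
qed simp

text \<open>The Cameron-Martin formula in finite dimension. It turns every shift of the argument into a
  smooth weight, which is how differentiability is produced below from functions \<open>g\<close> that are only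
  measurable, and how a drift becomes a change of density.\<close>

lemma integral_std_gauss_shift:
  fixes g :: "'a::euclidean_space \<Rightarrow> 'b::{banach, second_countable_topology}"
  assumes [measurable]: "g \<in> borel_measurable borel"
  shows "(\<integral>z. g (z + k) \<partial>std_gauss) = (\<integral>z. exp (k \<bullet> z - (norm k)\<^sup>2 / 2) *\<^sub>R g z \<partial>std_gauss)"
proof -
  have hk: "heat_kernel 1 0 z = heat_kernel 1 0 (k + z) * exp (k \<bullet> (k + z) - (norm k)\<^sup>2 / 2)" for z :: 'a
    by (simp add: heat_kernel_def power2_norm_eq_inner inner_commute algebra_simps flip: exp_add)
       (simp add: field_simps)
  have "(\<integral>z. g (z + k) \<partial>std_gauss) = (\<integral>z. heat_kernel 1 0 z *\<^sub>R g (z + k) \<partial>lborel)"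
    by (simp add: std_gauss_def integral_density)
  also have "\<dots> = (\<integral>z. heat_kernel 1 0 (k + z) *\<^sub>R exp (k \<bullet> (k + z) - (norm k)\<^sup>2 / 2) *\<^sub>R g (k + z) \<partial>lborel)"
    unfolding scaleR_scaleR hk[symmetric] by (simp only: add.commute)
  also have "\<dots> = (\<integral>z. heat_kernel 1 0 z *\<^sub>R exp (k \<bullet> z - (norm k)\<^sup>2 / 2) *\<^sub>R g z \<partial>distr lborel borel ((+) k))"
    by (subst integral_distr) simp_all
  also have "\<dots> = (\<integral>z. exp (k \<bullet> z - (norm k)\<^sup>2 / 2) *\<^sub>R g z \<partial>std_gauss)"
    by (simp add: std_gauss_def integral_density lborel_distr_plus)
  finally show ?thesis .
qed

lemma integral_std_gauss_uminus:
  fixes g :: "'a::euclidean_space \<Rightarrow> 'b::{banach, second_countable_topology}"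
  assumes [measurable]: "g \<in> borel_measurable borel"
  shows "(\<integral>z. g (- z) \<partial>std_gauss) = (\<integral>z. g z \<partial>std_gauss)"
proof -
  have eq: "lborel = distr lborel (borel :: 'a measure) uminus"
    by (subst lborel_affine[of "-1" 0]) (simp_all add: density_1)
  have "(\<integral>z. g z \<partial>std_gauss) = (\<integral>z. heat_kernel 1 0 z *\<^sub>R g z \<partial>lborel)"
    by (simp add: std_gauss_def integral_density)
  also have "\<dots> = (\<integral>z. heat_kernel 1 0 (- z) *\<^sub>R g (- z) \<partial>lborel)"
    by (subst eq) (simp add: integral_distr)
  also have "\<dots> = (\<integral>z. g (- z) \<partial>std_gauss)"
    by (simp add: std_gauss_def integral_density heat_kernel_def)
  finally show ?thesis ..
qed

lemma integral_std_gauss_ident: "(\<integral>z. z \<partial>std_gauss) = (0 :: 'a::euclidean_space)"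
proof -
  have "(\<integral>z. z \<partial>std_gauss) = - (\<integral>z. z \<partial>(std_gauss :: 'a measure))"
    using integral_std_gauss_uminus[of "\<lambda>z::'a. z"] by simp
  then show ?thesis by (simp add: eq_neg_iff_add_eq_0 flip: scaleR_2)
qed

lemma integrable_std_gauss_exp_norm:
  "integrable (std_gauss :: 'a::euclidean_space measure) (\<lambda>z. exp (c * norm z))"
proof (rule integrableI_bounded)
  define K where "K = exp (c\<^sup>2) * (2 * pi) powr (- (real DIM('a) / 2)) / (4 * pi) powr (- (real DIM('a) / 2))"
  have le: "heat_kernel 1 0 z * exp (c * norm z) \<le> K * heat_kernel 2 0 z" for z :: 'a
  proof -
    have "0 \<le> (c - norm z / 2)\<^sup>2" by simp
    then have "c * norm z - (norm z)\<^sup>2 / 2 \<le> c\<^sup>2 - (norm z)\<^sup>2 / 4"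
      by (simp add: power2_diff field_simps)
    then have "exp (c * norm z) * exp (- (norm z)\<^sup>2 / 2) \<le> exp (c\<^sup>2) * exp (- (norm z)\<^sup>2 / 4)"
      by (simp flip: exp_add)
    then show ?thesis
      unfolding K_def heat_kernel_def by (simp add: mult_ac)
  qed
  have "(\<integral>\<^sup>+z. ennreal (norm (exp (c * norm z))) \<partial>(std_gauss :: 'a measure)) =
     (\<integral>\<^sup>+z. ennreal (heat_kernel 1 0 z * exp (c * norm z)) \<partial>(lborel :: 'a measure))"
    by (simp add: std_gauss_def nn_integral_density ennreal_mult)
  also have "\<dots> \<le> (\<integral>\<^sup>+z. ennreal K * ennreal (heat_kernel 2 0 z) \<partial>(lborel :: 'a measure))"
    using le by (intro nn_integral_mono) (simp add: K_def flip: ennreal_mult)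
  also have "\<dots> < \<infinity>"
    by (simp add: nn_integral_cmult nn_integral_heat_kernel)
  finally show "(\<integral>\<^sup>+z. ennreal (norm (exp (c * norm z))) \<partial>(std_gauss :: 'a measure)) < \<infinity>" .
qed simp

section \<open>Gaussian tilts and exponential moments\<close>

lemma abs_exp_minus_one_le: "\<bar>exp x - 1\<bar> \<le> \<bar>x\<bar> * exp \<bar>x\<bar>" for x :: real
proof -
  obtain t where t: "\<bar>t\<bar> \<le> \<bar>x\<bar>" "exp x = (\<Sum>m<1. x ^ m / fact m) + exp t / fact 1 * x ^ 1"
    using Maclaurin_exp_le[of x 1] by blast
  then have "\<bar>exp x - 1\<bar> = \<bar>x\<bar> * exp t"
    by (simp add: abs_mult)
  also have "\<dots> \<le> \<bar>x\<bar> * exp \<bar>x\<bar>"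
    using t by (intro mult_left_mono) auto
  finally show ?thesis .
qed

lemma abs_exp_minus_one_minus_le: "\<bar>exp x - 1 - x\<bar> \<le> x\<^sup>2 * exp \<bar>x\<bar>" for x :: real
proof -
  obtain t where t: "\<bar>t\<bar> \<le> \<bar>x\<bar>" "exp x = (\<Sum>m<2. x ^ m / fact m) + exp t / fact 2 * x ^ 2"
    using Maclaurin_exp_le[of x 2] by blast
  then have "exp x - 1 - x = exp t / 2 * x\<^sup>2"
    by (simp add: eval_nat_numeral)
  then have "\<bar>exp x - 1 - x\<bar> = exp t / 2 * x\<^sup>2"
    by (metis abs_of_nonneg exp_ge_zero half_gt_zero_iff less_imp_le mult_nonneg_nonneg exp_gt_zero zero_le_power2)
  also have "\<dots> \<le> exp \<bar>x\<bar> * x\<^sup>2"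
  proof (rule mult_right_mono)
    have "exp t \<le> exp \<bar>x\<bar>" using t by simp
    then show "exp t / 2 \<le> exp \<bar>x\<bar>" using exp_gt_zero[of t] by linarith
  qed simp
  finally show ?thesis by (simp add: mult.commute)
qed

lemma real_le_exp: "x \<le> exp x" for x :: real
  using exp_ge_add_one_self[of x] by linarith

text \<open>Cutting off at \<open>norm k \<le> 1\<close> keeps the exponential growth in \<open>z\<close> independent of \<open>k\<close>, so that one
  exponential moment serves for all tilts. Polynomial factors in \<open>z\<close> are absorbed into exponentials
  here and everywhere below.\<close>

lemma gauss_tilt_bounds:
  fixes k z :: "'a::real_inner"
  assumes "norm k \<le> 1"
  shows "\<bar>exp (k \<bullet> z - (norm k)\<^sup>2 / 2) - 1\<bar> \<le> 2 * norm k * exp (2 * norm z)"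
    and "\<bar>exp (k \<bullet> z - (norm k)\<^sup>2 / 2) - 1 - k \<bullet> z\<bar> \<le> 3 * (norm k)\<^sup>2 * exp (3 * norm z)"
proof -
  define a where "a = k \<bullet> z - (norm k)\<^sup>2 / 2"
  have "(norm k)\<^sup>2 \<le> norm k"
    using assms by (simp add: power2_eq_square mult_left_le)
  moreover have "\<bar>k \<bullet> z\<bar> \<le> norm k * norm z"
    by (rule Cauchy_Schwarz_ineq2)
  ultimately have a: "\<bar>a\<bar> \<le> norm k * (norm z + 1/2)"
    unfolding a_def distrib_left using zero_le_power2[of "norm k"] by linarith
  also have "\<dots> \<le> norm k * exp (norm z)"
    using exp_ge_add_one_self[of "norm z"] by (intro mult_left_mono) (linarith, simp)
  finally have a1: "\<bar>a\<bar> \<le> norm k * exp (norm z)" .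
  have "\<bar>a\<bar> \<le> norm z + 1/2"
    using a assms mult_right_mono[of "norm k" 1 "norm z + 1/2"] by simp
  then have "exp \<bar>a\<bar> \<le> exp (norm z) * exp (1/2)"
    by (simp flip: exp_add)
  also have "\<dots> \<le> exp (norm z) * 2"
    using exp_bound_half[of "1/2::real"] by (intro mult_left_mono) auto
  finally have a2: "exp \<bar>a\<bar> \<le> 2 * exp (norm z)" by simp
  have "\<bar>exp a - 1\<bar> \<le> \<bar>a\<bar> * exp \<bar>a\<bar>"
    by (rule abs_exp_minus_one_le)
  also have "\<dots> \<le> (norm k * exp (norm z)) * (2 * exp (norm z))"
    using a1 a2 by (intro mult_mono) auto
  also have "\<dots> = 2 * norm k * exp (2 * norm z)"
    by (simp add: exp_double power2_eq_square)
  finally show "\<bar>exp (k \<bullet> z - (norm k)\<^sup>2 / 2) - 1\<bar> \<le> 2 * norm k * exp (2 * norm z)"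
    by (simp add: a_def)
  have "\<bar>exp a - 1 - a\<bar> \<le> \<bar>a\<bar>\<^sup>2 * exp \<bar>a\<bar>"
    using abs_exp_minus_one_minus_le[of a] by simp
  also have "\<dots> \<le> (norm k * exp (norm z))\<^sup>2 * (2 * exp (norm z))"
    using a1 a2 by (intro mult_mono power_mono) auto
  also have "\<dots> = 2 * (norm k)\<^sup>2 * exp (3 * norm z)"
    by (simp add: power_mult_distrib power2_eq_square flip: exp_add)
  finally have "\<bar>exp a - 1 - a\<bar> \<le> 2 * (norm k)\<^sup>2 * exp (3 * norm z)" .
  moreover have "(norm k)\<^sup>2 / 2 \<le> (norm k)\<^sup>2 * exp (3 * norm z)"
  proof -
    have "(norm k)\<^sup>2 * 1 \<le> (norm k)\<^sup>2 * exp (3 * norm z)"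
      by (intro mult_left_mono) auto
    then show ?thesis using zero_le_power2[of "norm k"] by linarith
  qed
  ultimately show "\<bar>exp (k \<bullet> z - (norm k)\<^sup>2 / 2) - 1 - k \<bullet> z\<bar> \<le> 3 * (norm k)\<^sup>2 * exp (3 * norm z)"
    unfolding a_def mult.assoc using zero_le_power2[of "norm k"] by linarith
qed

lemma GDERIV_quadratic_remainder:
  fixes f :: "'a::real_inner \<Rightarrow> real"
  assumes r: "r > 0" and rem: "\<And>k. norm k \<le> r \<Longrightarrow> \<bar>f (y + k) - f y - k \<bullet> D\<bar> \<le> C * (norm k)\<^sup>2"
  shows "GDERIV f y :> D"
  unfolding gderiv_def
proof (rule has_derivativeI_sandwich[OF r])
  show "bounded_linear (\<lambda>h. h \<bullet> D)"
    by (rule bounded_linear_inner_left)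
  fix x assume x: "x \<noteq> y" "dist x y < r"
  then have "\<bar>f x - f y - (x - y) \<bullet> D\<bar> \<le> C * (norm (x - y))\<^sup>2"
    using rem[of "x - y"] by (simp add: dist_norm)
  then show "norm (f x - f y - (x - y) \<bullet> D) / norm (x - y) \<le> C * norm (x - y)"
    using x by (simp add: divide_simps power2_eq_square mult.assoc)
next
  have "((\<lambda>x. C * norm (x - y)) \<longlongrightarrow> C * norm (y - y)) (at y)"
    by (intro tendsto_intros)
  then show "((\<lambda>x. C * norm (x - y)) \<longlongrightarrow> 0) (at y)" by simp
qed

text \<open>The constants of all estimates are built from these moments; every integrand that has to be
  estimated is bounded by a multiple of some \<open>exp (c * norm z)\<close>.\<close>

definition exp_moment :: "'a::euclidean_space itself \<Rightarrow> real \<Rightarrow> real" where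
  "exp_moment _ c = (\<integral>z. exp (c * norm z) \<partial>(std_gauss :: 'a measure))"

lemma exp_moment_pos: "exp_moment TYPE('a::euclidean_space) c > 0"
proof -
  have "(\<integral>z. exp (c * norm z) \<partial>(std_gauss :: 'a measure)) \<noteq> 0"
    by (subst integral_nonneg_eq_0_iff_AE) (auto intro: integrable_std_gauss_exp_norm)
  moreover have "(\<integral>z. exp (c * norm z) \<partial>(std_gauss :: 'a measure)) \<ge> 0"
    by (rule integral_nonneg_AE) simp
  ultimately show ?thesis unfolding exp_moment_def by linarith
qed

lemma
  fixes f :: "'a::euclidean_space \<Rightarrow> 'b::{banach, second_countable_topology}"
  assumes [measurable]: "f \<in> borel_measurable borel"
    and le: "\<And>z. norm (f z) \<le> K * exp (c * norm z)"
  shows integrable_exp_dominated: "integrable std_gauss f"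
    and norm_integral_exp_dominated: "norm (\<integral>z. f z \<partial>std_gauss) \<le> K * exp_moment TYPE('a) c"
proof -
  have int: "integrable (std_gauss :: 'a measure) (\<lambda>z. K * exp (c * norm z))"
    by (intro integrable_mult_right integrable_std_gauss_exp_norm)
  show "integrable std_gauss f"
    using le order.trans[OF le abs_ge_self] by (intro Bochner_Integration.integrable_bound[OF int]) auto
  have "norm (\<integral>z. f z \<partial>std_gauss) \<le> (\<integral>z. K * exp (c * norm z) \<partial>(std_gauss :: 'a measure))"
    by (rule Bochner_Integration.integral_norm_bound_integral[OF \<open>integrable std_gauss f\<close> int]) (rule le)
  then show "norm (\<integral>z. f z \<partial>std_gauss) \<le> K * exp_moment TYPE('a) c"
    by (simp add: exp_moment_def)
qed

lemma integrable_std_gauss_ident: "integrable std_gauss (\<lambda>z::'a::euclidean_space. z)"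
  using real_le_exp by (intro integrable_exp_dominated[where K = 1 and c = 1]) auto

section \<open>The heat semigroup on log-Lipschitz functions\<close>

definition heat :: "real \<Rightarrow> ('a::euclidean_space \<Rightarrow> real) \<Rightarrow> 'a \<Rightarrow> real" where
  "heat s g y = (\<integral>z. g (y + sqrt s *\<^sub>R z) \<partial>std_gauss)"

text \<open>The gradient of \<open>heat s g\<close> after Gaussian integration by parts, so that \<open>g\<close> itself is not
  differentiated; see \<open>GDERIV_heat\<close> below.\<close>

definition heat_grad :: "real \<Rightarrow> ('a::euclidean_space \<Rightarrow> real) \<Rightarrow> 'a \<Rightarrow> 'a" where
  "heat_grad s g y = (\<integral>z. g (y + sqrt s *\<^sub>R z) *\<^sub>R z \<partial>std_gauss) /\<^sub>R sqrt s"

lemma measurable_heat [measurable]: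
  assumes [measurable]: "g \<in> borel_measurable borel"
  shows "heat s g \<in> borel_measurable borel" "heat_grad s g \<in> borel_measurable borel"
  unfolding heat_def[abs_def] heat_grad_def[abs_def] by measurable

lemma heat_0 [simp]: "heat 0 g y = g y"
  by (simp add: heat_def std_gauss.prob_space[simplified])

text \<open>The second assumption says that \<open>ln \<circ> \<phi>\<close> is \<open>L\<close>-Lipschitz. It makes \<open>\<phi> y\<close> a common yardstick: all
  averages of \<open>\<phi>\<close> around \<open>y\<close> up to the time horizon \<open>T\<close> are comparable with \<open>\<phi> y\<close>, uniformly in \<open>y\<close>,
  and the increments of heat averages and of their gradients are bounded relative to it.\<close>

locale log_lipschitz =
  fixes \<phi> :: "'a::euclidean_space \<Rightarrow> real" and L T :: real
  assumes phi_pos: "\<phi> y > 0"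
    and phi_le: "\<phi> (y + k) \<le> \<phi> y * exp (L * norm k)"
    and phi_measurable [measurable]: "\<phi> \<in> borel_measurable borel"
    and L_nonneg: "L \<ge> 0"
    and T_pos: "T > 0"
begin

abbreviation E :: "'a itself \<Rightarrow> real \<Rightarrow> real" where "E \<equiv> exp_moment"

lemma phi_diff_le: "\<bar>\<phi> (y + k) - \<phi> y\<bar> \<le> \<phi> y * (L * norm k * exp (L * norm k))"
proof -
  define x where "x = L * norm k"
  have x: "x \<ge> 0" using L_nonneg by (simp add: x_def)
  have "\<phi> y \<le> \<phi> (y + k) * exp x"
    using phi_le[of "y + k" "- k"] by (simp add: x_def)
  then have lower: "\<phi> y * exp (- x) \<le> \<phi> (y + k)"
    by (simp add: exp_minus field_simps)
  have upper: "\<phi> (y + k) \<le> \<phi> y * exp x"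
    using phi_le[of y k] by (simp add: x_def)
  have "1 - exp (- x) \<le> exp x - 1"
    using exp_ge_add_one_self[of x] exp_ge_add_one_self[of "- x"] by linarith
  then have "\<phi> y * (1 - exp (- x)) \<le> \<phi> y * (exp x - 1)"
    using phi_pos[of y] by (intro mult_left_mono) auto
  with lower upper have "\<bar>\<phi> (y + k) - \<phi> y\<bar> \<le> \<phi> y * (exp x - 1)"
    by (simp add: abs_le_iff algebra_simps)
  also have "exp x - 1 \<le> x * exp x"
    using abs_exp_minus_one_le[of x] x by simp
  finally show ?thesis
    using phi_pos[of y] by (simp add: x_def)
qed

lemma phi_spread:
  assumes "0 \<le> s" "s \<le> T"
  shows "\<phi> (y + sqrt s *\<^sub>R z) \<le> \<phi> y * exp (L * sqrt T * norm z)"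
proof -
  have "L * (sqrt s * norm z) \<le> L * (sqrt T * norm z)"
    using assms L_nonneg by (intro mult_left_mono mult_right_mono) auto
  then have "exp (L * norm (sqrt s *\<^sub>R z)) \<le> exp (L * sqrt T * norm z)"
    using assms by (simp add: mult.assoc)
  then show ?thesis
    using phi_le[of y "sqrt s *\<^sub>R z"] phi_pos[of y] by (meson mult_left_mono order.trans less_imp_le)
qed

text \<open>The functions \<open>g = f * \<phi>\<close> for measurable \<open>f\<close> with values in \<open>{-1..1}\<close>.\<close>

definition dominated :: "('a \<Rightarrow> real) \<Rightarrow> bool" where
  "dominated g \<longleftrightarrow> g \<in> borel_measurable borel \<and> (\<forall>y. \<bar>g y\<bar> \<le> \<phi> y)"

lemma dominated_phi: "dominated \<phi>"
  using phi_pos by (simp add: dominated_def less_imp_le)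

lemma dominated_measurable [measurable_dest]: "dominated g \<Longrightarrow> g \<in> borel_measurable borel"
  by (simp add: dominated_def)

lemma dominated_spread:
  assumes "dominated g" "0 \<le> s" "s \<le> T"
  shows "\<bar>g (y + sqrt s *\<^sub>R z)\<bar> \<le> \<phi> y * exp (L * sqrt T * norm z)"
  using assms phi_spread[of s y z] unfolding dominated_def by (meson order.trans)

lemma
  fixes h :: "'a \<Rightarrow> 'b::{banach, second_countable_topology}"
  assumes g: "dominated g" and s: "0 \<le> s" "s \<le> T"
    and [measurable]: "h \<in> borel_measurable borel"
    and h: "\<And>z. norm (h z) \<le> K * exp (c * norm z)"
  shows integrable_dominated: "integrable std_gauss (\<lambda>z. g (y + sqrt s *\<^sub>R z) *\<^sub>R h z)"
    and norm_integral_dominated: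
      "norm (\<integral>z. g (y + sqrt s *\<^sub>R z) *\<^sub>R h z \<partial>std_gauss) \<le> \<phi> y * K * E TYPE('a) (c + L * sqrt T)"
proof -
  note [measurable] = dominated_measurable[OF g]
  have le: "norm (g (y + sqrt s *\<^sub>R z) *\<^sub>R h z) \<le> \<phi> y * K * exp ((c + L * sqrt T) * norm z)" for z
  proof -
    have "norm (g (y + sqrt s *\<^sub>R z) *\<^sub>R h z) \<le>
        (\<phi> y * exp (L * sqrt T * norm z)) * (K * exp (c * norm z))"
      unfolding norm_scaleR using dominated_spread[OF g s] h phi_pos[of y]
      by (intro mult_mono) (auto simp: less_imp_le)
    also have "\<dots> = \<phi> y * K * exp ((c + L * sqrt T) * norm z)"
      by (simp add: algebra_simps flip: exp_add)
    finally show ?thesis .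
  qed
  show "integrable std_gauss (\<lambda>z. g (y + sqrt s *\<^sub>R z) *\<^sub>R h z)"
    by (rule integrable_exp_dominated[OF _ le]) simp
  show "norm (\<integral>z. g (y + sqrt s *\<^sub>R z) *\<^sub>R h z \<partial>std_gauss) \<le> \<phi> y * K * E TYPE('a) (c + L * sqrt T)"
    by (rule norm_integral_exp_dominated[OF _ le]) simp
qed

lemma integrable_heat:
  assumes "dominated g" "0 \<le> s" "s \<le> T"
  shows "integrable std_gauss (\<lambda>z. g (y + sqrt s *\<^sub>R z))"
  using integrable_dominated[OF assms, of "\<lambda>_. 1::real" 1 0 y] by simp

lemma integrable_heat_grad:
  assumes "dominated g" "0 \<le> s" "s \<le> T"
  shows "integrable std_gauss (\<lambda>z. g (y + sqrt s *\<^sub>R z) *\<^sub>R z)"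
  using integrable_dominated[OF assms, of "\<lambda>z. z" 1 1 y] real_le_exp by simp

lemma heat_phi_ge:
  assumes s: "0 \<le> s" "s \<le> T"
  shows "\<phi> y * E TYPE('a) (- (L * sqrt T)) \<le> heat s \<phi> y"
proof -
  have "(\<integral>z. \<phi> y * exp (- (L * sqrt T) * norm z) \<partial>(std_gauss :: 'a measure)) \<le> heat s \<phi> y"
    unfolding heat_def
  proof (rule integral_mono)
    fix z :: 'a
    have "\<phi> y \<le> \<phi> (y + sqrt s *\<^sub>R z) * exp (L * norm (sqrt s *\<^sub>R z))"
      using phi_le[of "y + sqrt s *\<^sub>R z" "- (sqrt s *\<^sub>R z)"] by simp
    also have "\<dots> \<le> \<phi> (y + sqrt s *\<^sub>R z) * exp (L * sqrt T * norm z)"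
      using s L_nonneg phi_pos[of "y + sqrt s *\<^sub>R z"]
      by (intro mult_left_mono) (auto simp: mult.assoc intro!: mult_left_mono mult_right_mono)
    finally show "\<phi> y * exp (- (L * sqrt T) * norm z) \<le> \<phi> (y + sqrt s *\<^sub>R z)"
      by (simp add: exp_minus field_simps)
  qed (intro integrable_mult_right integrable_std_gauss_exp_norm integrable_heat[OF dominated_phi s])+
  then show ?thesis by (simp add: exp_moment_def)
qed

lemma heat_phi_pos:
  assumes "0 \<le> s" "s \<le> T"
  shows "heat s \<phi> y > 0"
  using heat_phi_ge[OF assms, of y] phi_pos[of y] exp_moment_pos[where 'a='a]
  by (meson less_le_trans mult_pos_pos)

lemma abs_heat_le:
  assumes g: "dominated g" and s: "0 \<le> s" "s \<le> T"
  shows "\<bar>heat s g y\<bar> \<le> heat s \<phi> y"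
  unfolding heat_def
  using Bochner_Integration.integral_norm_bound_integral[OF integrable_heat[OF g s] integrable_heat[OF dominated_phi s]] g
  by (simp add: dominated_def)

text \<open>Moving the starting point by \<open>k\<close> tilts the Gaussian weight by \<open>k / sqrt s\<close>, and the increments of
  \<open>heat s g\<close> reduce to the expansion of the tilt in \<open>gauss_tilt_bounds\<close>.\<close>

lemma
  assumes g: "dominated g" and s: "0 < s" "s \<le> T" and k: "norm k \<le> sqrt s"
  shows heat_diff_le:
      "\<bar>heat s g (y + k) - heat s g y\<bar> \<le> \<phi> y * (2 * (norm k / sqrt s)) * E TYPE('a) (2 + L * sqrt T)"
    and heat_taylor_le:
      "\<bar>heat s g (y + k) - heat s g y - k \<bullet> heat_grad s g y\<bar> \<le>
         \<phi> y * (3 * (norm k / sqrt s)\<^sup>2) * E TYPE('a) (3 + L * sqrt T)"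
proof -
  note [measurable] = dominated_measurable[OF g]
  define m where "m = k /\<^sub>R sqrt s"
  have k_eq: "k = sqrt s *\<^sub>R m" and norm_m: "norm m = norm k / sqrt s"
    using s by (simp_all add: m_def divide_inverse mult.commute)
  have m1: "norm m \<le> 1"
    using s k by (simp add: norm_m)
  let ?e = "\<lambda>z. exp (m \<bullet> z - (norm m)\<^sup>2 / 2)"
  have s0: "0 \<le> s" using s by simp
  note tilt = gauss_tilt_bounds[OF m1]
  have arg: "y + k + sqrt s *\<^sub>R z = y + sqrt s *\<^sub>R (z + m)" for z
    by (simp add: k_eq algebra_simps)
  have shift: "heat s g (y + k) = (\<integral>z. g (y + sqrt s *\<^sub>R z) *\<^sub>R ?e z \<partial>std_gauss)"
    using integral_std_gauss_shift[of "\<lambda>z. g (y + sqrt s *\<^sub>R z)" m]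
    by (simp add: heat_def arg mult.commute)
  have b1: "norm (?e z - 1) \<le> (2 * norm m) * exp (2 * norm z)" for z
    using tilt(1)[of z] by simp
  have b2: "norm (?e z - 1 - m \<bullet> z) \<le> (3 * (norm m)\<^sup>2) * exp (3 * norm z)" for z
    using tilt(2)[of z] by simp
  note i0 = integrable_heat[OF g s0 s(2), of y]
  have i1: "integrable std_gauss (\<lambda>z. g (y + sqrt s *\<^sub>R z) *\<^sub>R (?e z - 1))"
    by (rule integrable_dominated[OF g s0 s(2) _ b1]) simp
  then have i2: "integrable std_gauss (\<lambda>z. g (y + sqrt s *\<^sub>R z) *\<^sub>R ?e z)"
    using Bochner_Integration.integrable_add[OF i1 i0] by (simp add: algebra_simps)
  have i3: "integrable std_gauss (\<lambda>z. g (y + sqrt s *\<^sub>R z) *\<^sub>R (m \<bullet> z))"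
    using integrable_inner_right[OF integrable_heat_grad[OF g s0 s(2), of y], of m] by simp
  have grad: "k \<bullet> heat_grad s g y = (\<integral>z. g (y + sqrt s *\<^sub>R z) *\<^sub>R (m \<bullet> z) \<partial>std_gauss)"
    using s integral_inner_right[OF integrable_heat_grad[OF g s0 s(2), of y], of m]
    by (simp add: heat_grad_def k_eq)
  have "heat s g (y + k) - heat s g y = (\<integral>z. g (y + sqrt s *\<^sub>R z) *\<^sub>R (?e z - 1) \<partial>std_gauss)"
    unfolding shift using Bochner_Integration.integral_diff[OF i2 i0]
    by (simp add: heat_def algebra_simps)
  then show "\<bar>heat s g (y + k) - heat s g y\<bar> \<le> \<phi> y * (2 * (norm k / sqrt s)) * E TYPE('a) (2 + L * sqrt T)"
    using norm_integral_dominated[OF g s0 s(2) _ b1, of y] by (simp add: norm_m)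
  have "heat s g (y + k) - heat s g y - k \<bullet> heat_grad s g y =
      (\<integral>z. g (y + sqrt s *\<^sub>R z) *\<^sub>R (?e z - 1 - m \<bullet> z) \<partial>std_gauss)"
    unfolding shift grad
    using Bochner_Integration.integral_diff[OF Bochner_Integration.integrable_diff[OF i2 i0] i3]
      Bochner_Integration.integral_diff[OF i2 i0]
    by (simp add: heat_def algebra_simps)
  then show "\<bar>heat s g (y + k) - heat s g y - k \<bullet> heat_grad s g y\<bar> \<le>
         \<phi> y * (3 * (norm k / sqrt s)\<^sup>2) * E TYPE('a) (3 + L * sqrt T)"
    using norm_integral_dominated[OF g s0 s(2) _ b2, of y] by (simp add: norm_m)
qed

lemma GDERIV_heat:
  assumes g: "dominated g" and s: "0 < s" "s \<le> T"
  shows "GDERIV (heat s g) y :> heat_grad s g y"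
proof (rule GDERIV_quadratic_remainder)
  show "sqrt s > 0" using s by simp
  fix k :: 'a assume "norm k \<le> sqrt s"
  from heat_taylor_le[OF g s this, of y]
  show "\<bar>heat s g (y + k) - heat s g y - k \<bullet> heat_grad s g y\<bar> \<le>
      \<phi> y * 3 / s * E TYPE('a) (3 + L * sqrt T) * (norm k)\<^sup>2"
    using s by (simp add: power_divide mult_ac)
qed

text \<open>For \<open>norm k \<le> sqrt s\<close>, numerator and denominator both vary by at most a multiple of
  \<open>\<phi> y * norm k / sqrt s\<close>, while the denominator is at least a multiple of \<open>\<phi> y\<close>. For larger \<open>k\<close> the
  tilt bounds are not available, but there the trivial bound \<open>2\<close> is good enough.\<close>

lemma heat_ratio_lipschitz:
  assumes g: "dominated g" and s: "0 < s" "s \<le> T"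
  shows "\<bar>heat s g (y + k) / heat s \<phi> (y + k) - heat s g y / heat s \<phi> y\<bar> \<le>
    (2 + 4 * E TYPE('a) (2 + L * sqrt T) / E TYPE('a) (- (L * sqrt T))) * (norm k / sqrt s)"
proof -
  have s0: "0 \<le> s" using s by simp
  define N U N' U' where "N = heat s g y" and "U = heat s \<phi> y"
    and "N' = heat s g (y + k)" and "U' = heat s \<phi> (y + k)"
  define A where "A = E TYPE('a) (2 + L * sqrt T)"
  define m where "m = E TYPE('a) (- (L * sqrt T))"
  define r where "r = norm k / sqrt s"
  have A: "A > 0" and m: "m > 0"
    by (simp_all add: A_def m_def exp_moment_pos)
  have r: "r \<ge> 0" using s by (simp add: r_def)
  have pos: "U > 0" "U' > 0"
    using heat_phi_pos[OF s0 s(2)] by (simp_all add: U_def U'_def)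
  have N: "\<bar>N\<bar> \<le> U" "\<bar>N'\<bar> \<le> U'"
    using abs_heat_le[OF g s0 s(2)] by (simp_all add: N_def U_def N'_def U'_def)
  have "\<bar>N' / U' - N / U\<bar> \<le> (2 + 4 * A / m) * r"
  proof (cases "r \<le> 1")
    case True
    then have k: "norm k \<le> sqrt s" using s by (simp add: r_def field_simps)
    have dN: "\<bar>N' - N\<bar> \<le> \<phi> y * (2 * r) * A" and dU: "\<bar>U' - U\<bar> \<le> \<phi> y * (2 * r) * A"
      using heat_diff_le[OF g s k, of y] heat_diff_le[OF dominated_phi s k, of y]
      by (simp_all add: N_def U_def N'_def U'_def A_def r_def)
    have low: "\<phi> y * m \<le> U"
      using heat_phi_ge[OF s0 s(2), of y] by (simp add: U_def m_def)
    have "N' / U' - N / U = ((N' - N) - N' / U' * (U' - U)) / U"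
      using pos by (simp add: diff_divide_distrib right_diff_distrib)
    moreover have "\<bar>(N' - N) - N' / U' * (U' - U)\<bar> \<le> \<bar>N' - N\<bar> + \<bar>N' / U'\<bar> * \<bar>U' - U\<bar>"
      using abs_triangle_ineq4[of "N' - N" "N' / U' * (U' - U)"] unfolding abs_mult .
    ultimately have "\<bar>N' / U' - N / U\<bar> \<le> (\<bar>N' - N\<bar> + \<bar>N' / U'\<bar> * \<bar>U' - U\<bar>) / U"
      using pos by (metis abs_divide abs_of_pos divide_right_mono less_imp_le)
    also have "\<dots> \<le> (\<phi> y * (2 * r) * A + 1 * (\<phi> y * (2 * r) * A)) / U"
      using dN dU N pos by (intro divide_right_mono add_mono mult_mono) auto
    also have "\<dots> \<le> (\<phi> y * (2 * r) * A + 1 * (\<phi> y * (2 * r) * A)) / (\<phi> y * m)"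
      using low m A r phi_pos[of y] pos by (intro divide_left_mono) (auto intro!: mult_pos_pos)
    also have "\<dots> = 4 * A / m * r"
      using phi_pos[of y] by (simp add: field_simps)
    also have "\<dots> \<le> (2 + 4 * A / m) * r"
      using r by (intro mult_right_mono) auto
    finally show ?thesis .
  next
    case False
    have "\<bar>N' / U'\<bar> \<le> 1" "\<bar>N / U\<bar> \<le> 1"
      using N pos by simp_all
    then have "\<bar>N' / U' - N / U\<bar> \<le> 2 * 1" by linarith
    also have "\<dots> \<le> (2 + 4 * A / m) * r"
      using False A m by (intro mult_mono) auto
    finally show ?thesis .
  qed
  then show ?thesis
    by (simp add: N_def U_def N'_def U'_def A_def m_def r_def)
qed


text \<open>Unlike for general dominated functions there is no blow-up as \<open>s\<close> tends to \<open>0\<close>: since the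
  Gaussian is centred, \<open>\<phi> y\<close> may be subtracted from the integrand, and the increment of \<open>\<phi>\<close> over a
  distance \<open>sqrt s * norm z\<close> cancels the factor \<open>1 / sqrt s\<close>.\<close>

lemma norm_heat_grad_phi_le:
  assumes s: "0 < s" "s \<le> T"
  shows "norm (heat_grad s \<phi> y) \<le> \<phi> y * L * E TYPE('a) (2 + L * sqrt T)"
proof -
  have s0: "0 \<le> s" using s by simp
  have "(\<integral>z. \<phi> (y + sqrt s *\<^sub>R z) *\<^sub>R z \<partial>std_gauss) =
      (\<integral>z. (\<phi> (y + sqrt s *\<^sub>R z) - \<phi> y) *\<^sub>R z \<partial>std_gauss)"
  proof -
    show ?thesis
      using Bochner_Integration.integral_diff[OF integrable_heat_grad[OF dominated_phi s0 s(2), of y]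
          integrable_scaleR_right[OF integrable_std_gauss_ident, of "\<phi> y"]]
      by (simp add: scaleR_diff_left integral_std_gauss_ident)
  qed
  also have "norm \<dots> \<le> (\<phi> y * L * sqrt s) * E TYPE('a) (2 + L * sqrt T)"
  proof (rule norm_integral_exp_dominated)
    fix z :: 'a
    have "norm ((\<phi> (y + sqrt s *\<^sub>R z) - \<phi> y) *\<^sub>R z) \<le>
        (\<phi> y * (L * norm (sqrt s *\<^sub>R z) * exp (L * norm (sqrt s *\<^sub>R z)))) * norm z"
      unfolding norm_scaleR using phi_diff_le[of y "sqrt s *\<^sub>R z"] by (simp add: mult_right_mono)
    also have "\<dots> = \<phi> y * L * sqrt s * (norm z * norm z * exp (L * sqrt s * norm z))"
      using s by (simp add: mult_ac)
    also have "\<dots> \<le> \<phi> y * L * sqrt s * (exp (norm z) * exp (norm z) * exp (L * sqrt T * norm z))"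
      using s L_nonneg phi_pos[of y] real_le_exp[of "norm z"]
      by (intro mult_left_mono mult_mono) (auto intro!: mult_right_mono mult_left_mono simp: less_imp_le)
    also have "\<dots> = \<phi> y * L * sqrt s * exp ((2 + L * sqrt T) * norm z)"
      by (simp add: algebra_simps flip: exp_add)
    finally show "norm ((\<phi> (y + sqrt s *\<^sub>R z) - \<phi> y) *\<^sub>R z) \<le>
        \<phi> y * L * sqrt s * exp ((2 + L * sqrt T) * norm z)" .
  qed simp
  finally show ?thesis
    using s by (simp add: heat_grad_def divide_simps mult_ac)
qed

text \<open>Differencing \<open>\<phi>\<close> rather than the Gaussian weight costs only one factor \<open>1 / sqrt s\<close> instead of
  \<open>1 / s\<close>. This better order of the second derivatives is what keeps the sum of the Euler errors
  small up to the terminal time.\<close>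

lemma heat_grad_phi_diff_le:
  assumes s: "0 < s" "s \<le> T"
  shows "norm (heat_grad s \<phi> (y + k) - heat_grad s \<phi> y) \<le>
    \<phi> y * (L * norm k * exp (L * norm k)) * E TYPE('a) (1 + L * sqrt T) / sqrt s"
proof -
  have s0: "0 \<le> s" using s by simp
  let ?K = "L * norm k * exp (L * norm k)"
  have K: "?K \<ge> 0" using L_nonneg by simp
  have "norm (\<integral>z. (\<phi> (y + k + sqrt s *\<^sub>R z) - \<phi> (y + sqrt s *\<^sub>R z)) *\<^sub>R z \<partial>std_gauss) \<le>
      (\<phi> y * ?K) * E TYPE('a) (1 + L * sqrt T)"
  proof (rule norm_integral_exp_dominated)
    fix z :: 'a
    have "norm ((\<phi> (y + k + sqrt s *\<^sub>R z) - \<phi> (y + sqrt s *\<^sub>R z)) *\<^sub>R z) \<le>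
        (\<phi> (y + sqrt s *\<^sub>R z) * ?K) * norm z"
      unfolding norm_scaleR using phi_diff_le[of "y + sqrt s *\<^sub>R z" k]
      by (intro mult_right_mono) (simp_all add: add.assoc add.commute add.left_commute)
    also have "\<dots> \<le> (\<phi> y * exp (L * sqrt T * norm z) * ?K) * exp (norm z)"
      using phi_spread[OF s0 s(2), of y z] K phi_pos[of y] phi_pos[of "y + sqrt s *\<^sub>R z"] real_le_exp[of "norm z"]
      using L_nonneg by (intro mult_mono) (auto simp: less_imp_le)
    also have "\<dots> = \<phi> y * ?K * exp ((1 + L * sqrt T) * norm z)"
      by (simp add: algebra_simps flip: exp_add)
    finally show "norm ((\<phi> (y + k + sqrt s *\<^sub>R z) - \<phi> (y + sqrt s *\<^sub>R z)) *\<^sub>R z) \<le>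
        \<phi> y * ?K * exp ((1 + L * sqrt T) * norm z)" .
  qed simp
  moreover have "heat_grad s \<phi> (y + k) - heat_grad s \<phi> y =
      (\<integral>z. (\<phi> (y + k + sqrt s *\<^sub>R z) - \<phi> (y + sqrt s *\<^sub>R z)) *\<^sub>R z \<partial>std_gauss) /\<^sub>R sqrt s"
    using Bochner_Integration.integral_diff[OF integrable_heat_grad[OF dominated_phi s0 s(2), of "y + k"]
        integrable_heat_grad[OF dominated_phi s0 s(2), of y]]
    by (simp add: heat_grad_def scaleR_diff_left scaleR_diff_right)
  ultimately show ?thesis
    using s by (simp add: divide_right_mono divide_inverse mult.commute)
qed

lemma heat_phi_taylor_le:
  assumes s: "0 < s" "s \<le> T"
  shows "\<bar>heat s \<phi> (y + k) - heat s \<phi> y - k \<bullet> heat_grad s \<phi> y\<bar> \<le>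
    \<phi> y * (L * (norm k)\<^sup>2 * exp (L * norm k)) * E TYPE('a) (1 + L * sqrt T) / sqrt s"
proof -
  let ?E = "E TYPE('a) (1 + L * sqrt T)"
  have deriv: "((\<lambda>t. heat s \<phi> (y + t *\<^sub>R k)) has_real_derivative k \<bullet> heat_grad s \<phi> (y + t *\<^sub>R k)) (at t)" for t
  proof -
    have "(heat s \<phi> has_derivative (\<lambda>h. h \<bullet> heat_grad s \<phi> (y + t *\<^sub>R k))) (at (y + t *\<^sub>R k))"
      using GDERIV_heat[OF dominated_phi s, of "y + t *\<^sub>R k"] unfolding gderiv_def .
    then have "((\<lambda>t. heat s \<phi> (y + t *\<^sub>R k)) has_derivative (\<lambda>h. (h *\<^sub>R k) \<bullet> heat_grad s \<phi> (y + t *\<^sub>R k))) (at t)"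
      by (rule has_derivative_compose[rotated]) (auto intro!: derivative_eq_intros)
    then show ?thesis
      unfolding has_field_derivative_def by (rule has_derivative_eq_rhs) (simp add: fun_eq_iff)
  qed
  obtain t where t: "0 < t" "t < 1"
    "heat s \<phi> (y + 1 *\<^sub>R k) - heat s \<phi> (y + 0 *\<^sub>R k) = (1 - 0) * (k \<bullet> heat_grad s \<phi> (y + t *\<^sub>R k))"
    using MVT2[of 0 1 "\<lambda>t. heat s \<phi> (y + t *\<^sub>R k)" "\<lambda>t. k \<bullet> heat_grad s \<phi> (y + t *\<^sub>R k)"] deriv
    by auto
  then have "heat s \<phi> (y + k) - heat s \<phi> y - k \<bullet> heat_grad s \<phi> y =
      k \<bullet> (heat_grad s \<phi> (y + t *\<^sub>R k) - heat_grad s \<phi> y)"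
    by (simp add: inner_diff_right)
  also have "\<bar>\<dots>\<bar> \<le> norm k * norm (heat_grad s \<phi> (y + t *\<^sub>R k) - heat_grad s \<phi> y)"
    by (rule Cauchy_Schwarz_ineq2)
  also have "\<dots> \<le> norm k * (\<phi> y * (L * norm (t *\<^sub>R k) * exp (L * norm (t *\<^sub>R k))) * ?E / sqrt s)"
    by (intro mult_left_mono heat_grad_phi_diff_le s) simp
  also have "\<dots> \<le> norm k * (\<phi> y * (L * norm k * exp (L * norm k)) * ?E / sqrt s)"
  proof -
    have "norm (t *\<^sub>R k) \<le> norm k" using t by (simp add: mult_left_le_one_le)
    then have le: "L * norm (t *\<^sub>R k) \<le> L * norm k" using L_nonneg by (rule mult_left_mono)
    then have "exp (L * norm (t *\<^sub>R k)) \<le> exp (L * norm k)" by (simp only: exp_le_cancel_iff)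
    from mult_mono[OF le this]
    have "L * norm (t *\<^sub>R k) * exp (L * norm (t *\<^sub>R k)) \<le> L * norm k * exp (L * norm k)"
      using L_nonneg by simp
    then show ?thesis
      using phi_pos[of y] s exp_moment_pos[where 'a='a, of "1 + L * sqrt T"]
      by (intro mult_left_mono divide_right_mono mult_right_mono) (auto simp: less_imp_le)
  qed
  also have "\<dots> = \<phi> y * (L * (norm k)\<^sup>2 * exp (L * norm k)) * ?E / sqrt s"
    by (simp add: power2_eq_square)
  finally show ?thesis .
qed

lemma heat_heat:
  assumes g: "dominated g" and a: "a > 0" and b: "b > 0" and ab: "a + b \<le> T"
  shows "heat a (heat b g) y = heat (a + b) g y"
proof -
  note [measurable] = dominated_measurable[OF g]
  let ?P = "std_gauss \<Otimes>\<^sub>M std_gauss :: ('a \<times> 'a) measure"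
  let ?q = "\<lambda>(x::'a, z). sqrt a *\<^sub>R x + sqrt b *\<^sub>R z"
  have eq: "distr ?P borel ?q = distr std_gauss borel (\<lambda>z. sqrt (a + b) *\<^sub>R z)"
    by (rule distr_std_gauss_add[OF a b])
  have "integrable std_gauss (\<lambda>z. g (y + sqrt (a + b) *\<^sub>R z))"
    using a b ab by (intro integrable_heat[OF g]) auto
  then have "integrable (distr ?P borel ?q) (\<lambda>v. g (y + v))"
    unfolding eq by (simp add: integrable_distr_eq)
  then have int: "integrable ?P (\<lambda>p. g (y + ?q p))"
    by (subst (asm) integrable_distr_eq) simp_all
  have "heat a (heat b g) y = (\<integral>x. \<integral>z. g (y + ?q (x, z)) \<partial>std_gauss \<partial>std_gauss)"
    by (simp add: heat_def add.assoc)
  also have "\<dots> = (\<integral>p. g (y + ?q p) \<partial>?P)"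
    using std_gauss2.integral_fst'[OF int] by (simp add: split_beta)
  also have "\<dots> = (\<integral>v. g (y + v) \<partial>distr ?P borel ?q)"
    by (subst integral_distr) simp_all
  also have "\<dots> = heat (a + b) g y"
    unfolding eq by (subst integral_distr) (simp_all add: heat_def)
  finally show ?thesis .
qed

text \<open>The gradient commutes with averaging: the average of the gradients satisfies the quadratic
  remainder bound at \<open>y\<close>, so it is the gradient of \<open>heat h (heat s \<phi>)\<close>, which is \<open>heat (h + s) \<phi>\<close>
  by the semigroup law, and uniqueness of gradients identifies it with \<open>heat_grad (h + s) \<phi> y\<close>.\<close>

lemma
  assumes s: "0 < s" and h: "0 < h" and hs: "h + s \<le> T"
  shows integrable_heat_phi_step: "integrable std_gauss (\<lambda>z. heat s \<phi> (y + sqrt h *\<^sub>R z))"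
    and integrable_heat_grad_phi_step: "integrable std_gauss (\<lambda>z. heat_grad s \<phi> (y + sqrt h *\<^sub>R z))"
    and heat_grad_phi_step: "heat_grad (h + s) \<phi> y = (\<integral>z. heat_grad s \<phi> (y + sqrt h *\<^sub>R z) \<partial>std_gauss)"
proof -
  have s0: "0 \<le> s" "s \<le> T" and h0: "0 \<le> h" "h \<le> T" using s h hs by auto
  let ?X = "\<lambda>z. y + sqrt h *\<^sub>R z"
  have i1: "integrable std_gauss (\<lambda>z. heat s \<phi> (y + sqrt h *\<^sub>R z))" for y :: 'a
  proof -
    have "norm (heat s \<phi> x) \<le> \<phi> x * E TYPE('a) (0 + L * sqrt T)" for x
      using norm_integral_dominated[OF dominated_phi s0, of "\<lambda>_. 1::real" 1 0 x] by (simp add: heat_def)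
    then have "norm (heat s \<phi> x) \<le> norm (\<phi> x * E TYPE('a) (0 + L * sqrt T))" for x
      unfolding real_norm_def by (meson order.trans abs_ge_self)
    then show ?thesis
      using integrable_mult_left[OF integrable_heat[OF dominated_phi h0, of y], of "E TYPE('a) (0 + L * sqrt T)"]
      by (elim Bochner_Integration.integrable_bound) (simp_all only: AE_I2, measurable)
  qed
  show "integrable std_gauss (\<lambda>z. heat s \<phi> (?X z))"
    by (rule i1)
  show i2: "integrable std_gauss (\<lambda>z. heat_grad s \<phi> (?X z))"
  proof -
    have "norm (heat_grad s \<phi> x) \<le> \<phi> x * (L * E TYPE('a) (2 + L * sqrt T))" for x
      using norm_heat_grad_phi_le[OF s s0(2), of x] by (simp add: mult.assoc)
    then have "norm (heat_grad s \<phi> x) \<le> norm (\<phi> x * (L * E TYPE('a) (2 + L * sqrt T)))" for x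
      unfolding real_norm_def by (meson order.trans abs_ge_self)
    then show ?thesis
      using integrable_mult_left[OF integrable_heat[OF dominated_phi h0, of y], of "L * E TYPE('a) (2 + L * sqrt T)"]
      by (elim Bochner_Integration.integrable_bound) (simp_all only: AE_I2, measurable)
  qed
  let ?D = "\<integral>z. heat_grad s \<phi> (?X z) \<partial>std_gauss"
  let ?C = "L * exp L * E TYPE('a) (1 + L * sqrt T) / sqrt s"
  have C: "?C \<ge> 0" using L_nonneg s exp_moment_pos[where 'a='a, of "1 + L * sqrt T"] by simp
  have "GDERIV (heat (h + s) \<phi>) y :> ?D"
  proof (rule GDERIV_quadratic_remainder)
    fix k :: 'a assume k: "norm k \<le> 1"
    let ?r = "\<lambda>x. heat s \<phi> (x + k) - heat s \<phi> x - k \<bullet> heat_grad s \<phi> x"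
    have rem: "\<bar>?r x\<bar> \<le> \<phi> x * (?C * (norm k)\<^sup>2)" for x
    proof -
      have "\<bar>?r x\<bar> \<le> \<phi> x * (L * (norm k)\<^sup>2 * exp (L * norm k)) * E TYPE('a) (1 + L * sqrt T) / sqrt s"
        by (rule heat_phi_taylor_le[OF s s0(2)])
      also have "\<dots> \<le> \<phi> x * (L * (norm k)\<^sup>2 * exp L) * E TYPE('a) (1 + L * sqrt T) / sqrt s"
      proof -
        have "exp (L * norm k) \<le> exp L"
          using mult_left_mono[OF k L_nonneg] by simp
        then show ?thesis
          using L_nonneg s phi_pos[of x] exp_moment_pos[where 'a='a, of "1 + L * sqrt T"]
          by (intro divide_right_mono mult_right_mono mult_left_mono) (auto simp: less_imp_le)
      qed
      finally show ?thesis by (simp add: mult_ac)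
    qed
    have arg: "y + k + sqrt h *\<^sub>R z = ?X z + k" for z by simp
    have ik: "integrable std_gauss (\<lambda>z. heat s \<phi> (?X z + k))"
      using i1[of "y + k"] unfolding arg .
    have diff: "heat (h + s) \<phi> (y + k) - heat (h + s) \<phi> y - k \<bullet> ?D = (\<integral>z. ?r (?X z) \<partial>std_gauss)"
    proof -
      have "heat (h + s) \<phi> (y + k) = (\<integral>z. heat s \<phi> (?X z + k) \<partial>std_gauss)"
        unfolding heat_heat[OF dominated_phi h s hs, symmetric] heat_def[of h] arg ..
      moreover have "heat (h + s) \<phi> y = (\<integral>z. heat s \<phi> (?X z) \<partial>std_gauss)"
        unfolding heat_heat[OF dominated_phi h s hs, symmetric] heat_def[of h] ..
      moreover have "k \<bullet> ?D = (\<integral>z. k \<bullet> heat_grad s \<phi> (?X z) \<partial>std_gauss)"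
        using i2 by simp
      ultimately show ?thesis
        using ik i1[of y] integrable_inner_right[OF i2, of k]
        by (simp only: Bochner_Integration.integral_diff Bochner_Integration.integrable_diff)
    qed
    have "norm (\<integral>z. ?r (?X z) \<partial>std_gauss) \<le> (\<integral>z. \<phi> (?X z) * (?C * (norm k)\<^sup>2) \<partial>std_gauss)"
    proof (rule Bochner_Integration.integral_norm_bound_integral)
      show "integrable std_gauss (\<lambda>z. ?r (?X z))"
        by (intro Bochner_Integration.integrable_diff ik i1 integrable_inner_right i2)
      show "integrable std_gauss (\<lambda>z. \<phi> (?X z) * (?C * (norm k)\<^sup>2))"
        by (intro integrable_mult_left integrable_heat[OF dominated_phi h0])
      show "norm (?r (?X z)) \<le> \<phi> (?X z) * (?C * (norm k)\<^sup>2)" for z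
        unfolding real_norm_def by (rule rem)
    qed
    also have "\<dots> = heat h \<phi> y * ?C * (norm k)\<^sup>2"
      unfolding integral_mult_left_zero heat_def by (simp only: mult.assoc)
    finally show "\<bar>heat (h + s) \<phi> (y + k) - heat (h + s) \<phi> y - k \<bullet> ?D\<bar> \<le> heat h \<phi> y * ?C * (norm k)\<^sup>2"
      unfolding diff real_norm_def .
  qed simp
  moreover have "GDERIV (heat (h + s) \<phi>) y :> heat_grad (h + s) \<phi> y"
    using s h hs by (intro GDERIV_heat[OF dominated_phi]) auto
  ultimately show "heat_grad (h + s) \<phi> y = ?D"
    using GDERIV_unique by blast
qed

end

section \<open>One step of the Euler scheme\<close>

text \<open>Two densities of the same mass do not see constants, so \<open>F\<close> may be replaced by \<open>F - a\<close>: a small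
  oscillation of \<open>F\<close> and a small difference of the densities multiply.\<close>

lemma weighted_integral_diff_le:
  fixes F e f :: "'a::euclidean_space \<Rightarrow> real"
  assumes [measurable]: "F \<in> borel_measurable borel"
    and F1: "\<And>z. \<bar>F z\<bar> \<le> 1" and Fa: "\<And>z. \<bar>F z - a\<bar> \<le> r * exp (p * norm z)"
    and e: "integrable std_gauss e" "(\<integral>z. e z \<partial>std_gauss) = 1"
    and f: "integrable std_gauss f" "(\<integral>z. f z \<partial>std_gauss) = 1"
    and ef: "\<And>z. \<bar>e z - f z\<bar> \<le> d * exp (q * norm z)"
  shows "\<bar>(\<integral>z. F z * e z \<partial>std_gauss) - (\<integral>z. F z * f z \<partial>std_gauss)\<bar> \<le> r * d * exp_moment TYPE('a) (p + q)"
proof -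
  have r: "r * exp (p * norm z) \<ge> 0" for z :: 'a
    using order.trans[OF abs_ge_zero Fa] .
  have [measurable]: "e \<in> borel_measurable borel" "f \<in> borel_measurable borel"
    using borel_measurable_integrable[OF e(1)] borel_measurable_integrable[OF f(1)] by simp_all
  have bound: "integrable std_gauss (\<lambda>z. F z * x z)" if x: "integrable std_gauss x" for x
  proof (rule Bochner_Integration.integrable_bound[OF x])
    have [measurable]: "x \<in> borel_measurable borel"
      using borel_measurable_integrable[OF x] by simp
    show "(\<lambda>z. F z * x z) \<in> borel_measurable std_gauss" by measurable
    show "AE z in std_gauss. norm (F z * x z) \<le> norm (x z)"
      using F1 by (intro AE_I2) (simp add: abs_mult mult_left_le_one_le)
  qed
  have split: "(F z - a) * (e z - f z) = (F z * e z - F z * f z) - (a * e z - a * f z)" for z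
    by (simp add: algebra_simps)
  have "(\<integral>z. (F z - a) * (e z - f z) \<partial>std_gauss) =
      (\<integral>z. F z * e z \<partial>std_gauss) - (\<integral>z. F z * f z \<partial>std_gauss)"
    unfolding split using bound[OF e(1)] bound[OF f(1)] e f by simp
  moreover have "norm (\<integral>z. (F z - a) * (e z - f z) \<partial>std_gauss) \<le> r * d * exp_moment TYPE('a) (p + q)"
  proof (rule norm_integral_exp_dominated)
    fix z :: 'a
    have "norm ((F z - a) * (e z - f z)) \<le> (r * exp (p * norm z)) * (d * exp (q * norm z))"
      unfolding real_norm_def abs_mult using Fa[of z] ef[of z] r[of z] by (intro mult_mono) auto
    then show "norm ((F z - a) * (e z - f z)) \<le> r * d * exp ((p + q) * norm z)"
      by (simp add: algebra_simps flip: exp_add)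
  qed simp
  ultimately show ?thesis by simp
qed

lemma
  fixes k :: "'a::euclidean_space"
  assumes "norm k \<le> 1"
  shows integrable_gauss_tilt: "integrable std_gauss (\<lambda>z. exp (k \<bullet> z - (norm k)\<^sup>2 / 2))"
    and integral_gauss_tilt: "(\<integral>z. exp (k \<bullet> z - (norm k)\<^sup>2 / 2) \<partial>std_gauss) = 1"
proof -
  show "integrable std_gauss (\<lambda>z. exp (k \<bullet> z - (norm k)\<^sup>2 / 2))"
  proof (rule integrable_exp_dominated)
    fix z :: 'a
    have "2 * norm k * exp (2 * norm z) \<le> 2 * exp (2 * norm z)"
      using assms by simp
    moreover have "1 \<le> exp (2 * norm z)" by simp
    ultimately show "norm (exp (k \<bullet> z - (norm k)\<^sup>2 / 2)) \<le> 3 * exp (2 * norm z)"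
      using gauss_tilt_bounds(1)[OF assms, of z] unfolding real_norm_def by linarith
  qed simp
  show "(\<integral>z. exp (k \<bullet> z - (norm k)\<^sup>2 / 2) \<partial>std_gauss) = 1"
    using integral_std_gauss_shift[of "\<lambda>_. 1::real" k] by (simp add: std_gauss.prob_space[simplified])
qed

context log_lipschitz begin

text \<open>The step density has to be expanded around the constant and linear terms of the earlier time,
  where \<open>h + s\<close> remains. They arise from the Taylor expansion of \<open>heat s \<phi>\<close> by averaging over \<open>z\<close>: the
  linear term has mean zero, so the constant terms differ by a mean remainder, and the gradients
  differ by a mean gradient increment.\<close>

lemma heat_phi_step_expansion:
  obtains C where "C \<ge> 0"
    and "\<And>h s y z. 0 < h \<Longrightarrow> 0 < s \<Longrightarrow> h + s \<le> T \<Longrightarrow>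
      \<bar>heat s \<phi> (y + sqrt h *\<^sub>R z) - heat (h + s) \<phi> y - sqrt h * (heat_grad (h + s) \<phi> y \<bullet> z)\<bar>
        \<le> \<phi> y * (h / sqrt s * C) * exp ((2 + L * sqrt T) * norm z)"
proof
  let ?c = "L * sqrt T"
  define E1 E2 where "E1 = E TYPE('a) (1 + ?c)" and "E2 = E TYPE('a) (2 + ?c)"
  have E1: "E1 > 0" and E2: "E2 > 0" by (simp_all add: E1_def E2_def exp_moment_pos)
  show "L * E1 * (1 + E2 + E1) \<ge> 0" using L_nonneg E1 E2 by simp
  fix h s :: real and y z :: 'a
  assume h: "0 < h" and s: "0 < s" and hs: "h + s \<le> T"
  have sT: "s \<le> T" using h s hs by simp
  have exp_h: "exp (L * norm (sqrt h *\<^sub>R z)) \<le> exp (?c * norm z)" for z :: 'a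
    using h s hs L_nonneg by (auto simp: mult.assoc intro!: mult_left_mono mult_right_mono)
  \<comment> \<open>\<open>A\<close> is the order of the Taylor remainder at the distance \<open>sqrt h\<close>.\<close>
  define A where "A = \<phi> y * (h / sqrt s * (L * E1))"
  have A: "A \<ge> 0" using phi_pos[of y] L_nonneg h s E1 by (simp add: A_def less_imp_le)
  let ?w = "heat s \<phi>" and ?u = "heat (h + s) \<phi>" and ?Dw = "heat_grad s \<phi> y" and ?Du = "heat_grad (h + s) \<phi> y"
  let ?X = "\<lambda>z. y + sqrt h *\<^sub>R z"
  define r where "r z = ?w (?X z) - ?w y - sqrt h * (?Dw \<bullet> z)" for z
  have r_le: "norm (r z) \<le> A * exp ((2 + ?c) * norm z)" for z
  proof -
    have "\<bar>r z\<bar> \<le> \<phi> y * (L * (norm (sqrt h *\<^sub>R z))\<^sup>2 * exp (L * norm (sqrt h *\<^sub>R z))) * E1 / sqrt s"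
      using heat_phi_taylor_le[OF s sT, of y "sqrt h *\<^sub>R z"] by (simp add: r_def E1_def inner_commute)
    also have "\<dots> = A * ((norm z)\<^sup>2 * exp (L * norm (sqrt h *\<^sub>R z)))"
      using h by (simp add: A_def power_mult_distrib mult_ac)
    also have "\<dots> \<le> A * ((exp (norm z))\<^sup>2 * exp (?c * norm z))"
      using A real_le_exp[of "norm z"] exp_h[of z] by (intro mult_left_mono mult_mono power_mono) auto
    also have "\<dots> = A * exp ((2 + ?c) * norm z)"
      by (simp add: distrib_right exp_add exp_double)
    finally show ?thesis by simp
  qed
  have [measurable]: "r \<in> borel_measurable borel"
    unfolding r_def[abs_def] by measurable
  have "?u y = (\<integral>z. ?w (?X z) \<partial>std_gauss)"
    using heat_heat[OF dominated_phi h s hs, of y] by (simp add: heat_def[of h])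
  also have "\<dots> = (\<integral>z. r z + (?w y + sqrt h * (?Dw \<bullet> z)) \<partial>std_gauss)"
    by (simp add: r_def)
  also have "\<dots> = (\<integral>z. r z \<partial>std_gauss) + (\<integral>z. ?w y + sqrt h * (?Dw \<bullet> z) \<partial>std_gauss)"
    using integrable_std_gauss_ident[where 'a = 'a] by (intro Bochner_Integration.integral_add integrable_exp_dominated[OF _ r_le]) auto
  also have "(\<integral>z. ?w y + sqrt h * (?Dw \<bullet> z) \<partial>std_gauss) = ?w y"
    using integrable_std_gauss_ident[where 'a = 'a] by (simp add: integral_std_gauss_ident std_gauss.prob_space[simplified])
  finally have "\<bar>?u y - ?w y\<bar> \<le> A * E2"
    using norm_integral_exp_dominated[OF _ r_le] by (simp add: E2_def)
  moreover have "norm (?Du - ?Dw) \<le> \<phi> y * (L * sqrt h) * E1 / sqrt s * E1"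
  proof -
    have "?Du - ?Dw = (\<integral>z. heat_grad s \<phi> (?X z) - ?Dw \<partial>std_gauss)"
      using heat_grad_phi_step[OF s h hs, of y] integrable_heat_grad_phi_step[OF s h hs, of y]
      by (simp add: std_gauss.prob_space[simplified])
    also have "norm \<dots> \<le> \<phi> y * (L * sqrt h) * E1 / sqrt s * E TYPE('a) (1 + ?c)"
    proof (rule norm_integral_exp_dominated)
      fix z :: 'a
      have "norm (heat_grad s \<phi> (?X z) - ?Dw) \<le>
          \<phi> y * (L * norm (sqrt h *\<^sub>R z) * exp (L * norm (sqrt h *\<^sub>R z))) * E1 / sqrt s"
        unfolding E1_def by (rule heat_grad_phi_diff_le[OF s sT])
      also have "\<dots> = \<phi> y * (L * sqrt h) * E1 / sqrt s * (norm z * exp (L * norm (sqrt h *\<^sub>R z)))"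
        using h by (simp add: mult_ac)
      also have "\<dots> \<le> \<phi> y * (L * sqrt h) * E1 / sqrt s * (exp (norm z) * exp (?c * norm z))"
        using phi_pos[of y] L_nonneg h s E1 real_le_exp[of "norm z"] exp_h[of z]
        by (intro mult_left_mono mult_mono) (auto simp: less_imp_le)
      also have "\<dots> = \<phi> y * (L * sqrt h) * E1 / sqrt s * exp ((1 + ?c) * norm z)"
        by (simp add: distrib_right exp_add)
      finally show "norm (heat_grad s \<phi> (?X z) - ?Dw) \<le>
          \<phi> y * (L * sqrt h) * E1 / sqrt s * exp ((1 + ?c) * norm z)" .
    qed simp
    finally show ?thesis by (simp only: E1_def)
  qed
  then have "\<bar>sqrt h * ((?Du - ?Dw) \<bullet> z)\<bar> \<le> A * E1 * norm z"
  proof -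
    assume le: "norm (?Du - ?Dw) \<le> \<phi> y * (L * sqrt h) * E1 / sqrt s * E1"
    have "\<bar>sqrt h * ((?Du - ?Dw) \<bullet> z)\<bar> \<le> sqrt h * (norm (?Du - ?Dw) * norm z)"
      using h Cauchy_Schwarz_ineq2[of "?Du - ?Dw" z] by (simp add: abs_mult)
    also have "\<dots> \<le> sqrt h * (\<phi> y * (L * sqrt h) * E1 / sqrt s * E1 * norm z)"
      using le h by (intro mult_left_mono mult_right_mono) auto
    also have "\<dots> = (sqrt h * sqrt h) * (\<phi> y * L * E1 / sqrt s * E1 * norm z)"
      by (simp only: times_divide_eq_left times_divide_eq_right mult_ac)
    also have "\<dots> = A * E1 * norm z"
      using h by (simp add: A_def)
    finally show ?thesis .
  qed
  moreover have "?w (?X z) - ?u y - sqrt h * (?Du \<bullet> z) =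
      r z - (?u y - ?w y) - sqrt h * ((?Du - ?Dw) \<bullet> z)"
    by (simp add: r_def inner_diff_left right_diff_distrib)
  moreover note r_le[of z]
  ultimately have "\<bar>?w (?X z) - ?u y - sqrt h * (?Du \<bullet> z)\<bar> \<le> A * exp ((2 + ?c) * norm z) + A * E2 + A * E1 * norm z"
    unfolding real_norm_def by linarith
  also have "\<dots> \<le> A * exp ((2 + ?c) * norm z) + A * E2 * exp ((2 + ?c) * norm z) + A * E1 * exp ((2 + ?c) * norm z)"
  proof -
    have "?c * norm z \<ge> 0" using L_nonneg T_pos by simp
    then have le: "norm z \<le> (2 + ?c) * norm z" "0 \<le> (2 + ?c) * norm z"
      unfolding distrib_right using norm_ge_zero[of z] by linarith+
    then have "norm z \<le> exp ((2 + ?c) * norm z)" "1 \<le> exp ((2 + ?c) * norm z)"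
      using real_le_exp[of "(2 + ?c) * norm z"] by (linarith, simp only: one_le_exp_iff)
    then show ?thesis
      using A E1 E2 mult_left_mono[of 1 "exp ((2 + ?c) * norm z)" "A * E2"]
      by (intro add_mono mult_left_mono) simp_all
  qed
  also have "\<dots> = \<phi> y * (h / sqrt s * (L * E1 * (1 + E2 + E1))) * exp ((2 + ?c) * norm z)"
    by (simp add: A_def algebra_simps)
  finally show "\<bar>?w (?X z) - ?u y - sqrt h * (?Du \<bullet> z)\<bar> \<le>
      \<phi> y * (h / sqrt s * (L * E1 * (1 + E2 + E1))) * exp ((2 + ?c) * norm z)" .
qed

text \<open>Here and below \<open>s\<close> is the remaining time; this is the drift at the time \<open>T - s\<close>.\<close>

definition drift :: "real \<Rightarrow> 'a \<Rightarrow> 'a" where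
  "drift s y = heat_grad s \<phi> y /\<^sub>R heat s \<phi> y"

text \<open>The Doob transform of the heat semigroup by \<open>\<phi>\<close>: the expectation of \<open>g / \<phi>\<close> at the endpoint of
  the Schroedinger-Foellmer diffusion that is at \<open>y\<close> when the time \<open>s\<close> remains.\<close>

definition transform :: "real \<Rightarrow> ('a \<Rightarrow> real) \<Rightarrow> 'a \<Rightarrow> real" where
  "transform s g y = heat s g y / heat s \<phi> y"

lemma measurable_drift [measurable]: "drift s \<in> borel_measurable borel"
  unfolding drift_def[abs_def] by measurable

lemma measurable_transform [measurable]:
  assumes [THEN dominated_measurable, measurable]: "dominated g"
  shows "transform s g \<in> borel_measurable borel"
  unfolding transform_def[abs_def] by measurable

lemma abs_transform_le:
  assumes "dominated g" "0 \<le> s" "s \<le> T"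
  shows "\<bar>transform s g y\<bar> \<le> 1"
  using abs_heat_le[OF assms, of y] heat_phi_pos[OF assms(2,3), of y] by (simp add: transform_def)

lemma norm_drift_le:
  assumes s: "0 < s" "s \<le> T"
  shows "norm (drift s y) \<le> L * E TYPE('a) (2 + L * sqrt T) / E TYPE('a) (- (L * sqrt T))"
proof -
  define m where "m = E TYPE('a) (- (L * sqrt T))"
  have m: "m > 0" by (simp add: m_def exp_moment_pos)
  have s0: "0 \<le> s" using s by simp
  have "norm (drift s y) = norm (heat_grad s \<phi> y) / heat s \<phi> y"
    using heat_phi_pos[OF s0 s(2), of y] by (simp add: drift_def divide_inverse mult.commute)
  also have "\<dots> \<le> (\<phi> y * L * E TYPE('a) (2 + L * sqrt T)) / (\<phi> y * m)"
    using norm_heat_grad_phi_le[OF s, of y] heat_phi_ge[OF s0 s(2), of y] phi_pos[of y] m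
    by (intro frac_le) (auto simp: m_def intro: order.trans[OF norm_ge_zero])
  also have "\<dots> = L * E TYPE('a) (2 + L * sqrt T) / m"
    using phi_pos[of y] by simp
  finally show ?thesis by (simp only: m_def)
qed

text \<open>Relative to the Gaussian increment, the Euler step from \<open>y\<close> has the Cameron-Martin density
  \<open>exp (k \<bullet> z - (norm k)\<^sup>2 / 2)\<close> with \<open>k = sqrt h * drift\<close>, and the exact transition has the density
  \<open>heat s \<phi> (y + sqrt h * z) / heat (h + s) \<phi> y\<close>. Both are \<open>1 + k \<bullet> z\<close> up to an error of order
  \<open>h / sqrt s\<close>. In the last step, where \<open>s = 0\<close>, the function \<open>\<phi>\<close> need not be differentiable, and both
  densities are only compared with \<open>1\<close>.\<close>

lemma transition_density_diff_le:
  obtains C \<eta> where "C \<ge> 0" "\<eta> > 0"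
    and "\<And>h s y z. 0 < h \<Longrightarrow> h \<le> \<eta> \<Longrightarrow> 0 \<le> s \<Longrightarrow> h + s \<le> T \<Longrightarrow> norm (sqrt h *\<^sub>R drift (h + s) y) \<le> 1 \<and>
      \<bar>exp ((sqrt h *\<^sub>R drift (h + s) y) \<bullet> z - (norm (sqrt h *\<^sub>R drift (h + s) y))\<^sup>2 / 2)
          - heat s \<phi> (y + sqrt h *\<^sub>R z) / heat (h + s) \<phi> y\<bar>
        \<le> (if s = 0 then sqrt h else h / sqrt s) * C * exp ((3 + L * sqrt T) * norm z)"
proof -
  let ?c = "L * sqrt T"
  have c: "?c \<ge> 0" using L_nonneg T_pos by simp
  define m E1 where "m = E TYPE('a) (- ?c)" and "E1 = E TYPE('a) (1 + ?c)"
  have m: "m > 0" and E1: "E1 > 0" by (simp_all add: m_def E1_def exp_moment_pos)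
  define B where "B = L * E TYPE('a) (2 + ?c) / m"
  have B: "B \<ge> 0" using L_nonneg m exp_moment_pos[where 'a='a, of "2 + ?c"] by (simp add: B_def)
  obtain C where C: "C \<ge> 0" and expansion: "\<And>h s y z. 0 < h \<Longrightarrow> 0 < s \<Longrightarrow> h + s \<le> T \<Longrightarrow>
      \<bar>heat s \<phi> (y + sqrt h *\<^sub>R z) - heat (h + s) \<phi> y - sqrt h * (heat_grad (h + s) \<phi> y \<bullet> z)\<bar>
        \<le> \<phi> y * (h / sqrt s * C) * exp ((2 + ?c) * norm z)"
    using heat_phi_step_expansion by blast
  \<comment> \<open>\<open>C0\<close> is the constant for the last step, \<open>C1\<close> the one for all earlier steps.\<close>
  define C0 C1 where "C0 = 2 * B + (L + L * E1) / m" and "C1 = 3 * B\<^sup>2 * sqrt T + C / m"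
  have C0: "C0 \<ge> 0" and C1: "C1 \<ge> 0"
    using B C m E1 L_nonneg T_pos by (simp_all add: C0_def C1_def)
  \<comment> \<open>\<open>B\<close> bounds the drift, so \<open>h \<le> \<eta>\<close> gives \<open>norm k \<le> sqrt h * B \<le> 1\<close>, as the tilt bounds require.\<close>
  define \<eta> where "\<eta> = (1 / (B + 1))\<^sup>2"
  have eta: "\<eta> > 0" using B by (simp add: \<eta>_def)
  have "norm (sqrt h *\<^sub>R drift (h + s) y) \<le> 1 \<and>
      \<bar>exp ((sqrt h *\<^sub>R drift (h + s) y) \<bullet> z - (norm (sqrt h *\<^sub>R drift (h + s) y))\<^sup>2 / 2)
          - heat s \<phi> (y + sqrt h *\<^sub>R z) / heat (h + s) \<phi> y\<bar>
        \<le> (if s = 0 then sqrt h else h / sqrt s) * (C0 + C1) * exp ((3 + ?c) * norm z)"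
    if h: "0 < h" "h \<le> \<eta>" and s: "0 \<le> s" and hs: "h + s \<le> T" for h s :: real and y z :: 'a
  proof -
    define k where "k = sqrt h *\<^sub>R drift (h + s) y"
    let ?e = "exp (k \<bullet> z - (norm k)\<^sup>2 / 2)" and ?u = "heat (h + s) \<phi> y" and ?w = "heat s \<phi> (y + sqrt h *\<^sub>R z)"
    have hs0: "0 < h + s" "0 \<le> h + s" using h s by auto
    have kB: "norm k \<le> sqrt h * B"
      using mult_left_mono[OF norm_drift_le[OF hs0(1) hs, of y], of "sqrt h"] h by (simp add: k_def B_def m_def)
    have "sqrt h \<le> 1 / (B + 1)"
      using h B real_sqrt_le_mono[OF h(2)] by (simp add: \<eta>_def)
    then have "sqrt h * B \<le> 1 / (B + 1) * B"
      using B by (rule mult_right_mono)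
    also have "\<dots> \<le> 1" using B by simp
    finally have k1: "norm k \<le> 1" using kB by linarith
    have u: "?u > 0" and um: "\<phi> y * m \<le> ?u"
      using heat_phi_pos[OF hs0(2) hs, of y] heat_phi_ge[OF hs0(2) hs, of y] by (simp_all add: m_def)
    have weaken: "exp (j * norm z) \<le> exp ((3 + ?c) * norm z)" if "j \<le> 3 + ?c" for j
      using mult_right_mono[OF that norm_ge_zero[of z]] by simp
    have ratio: "\<bar>x / ?u\<bar> \<le> r / m * exp ((3 + ?c) * norm z)"
      if "\<bar>x\<bar> \<le> \<phi> y * r * exp (j * norm z)" "r \<ge> 0" "j \<le> 3 + ?c" for x r j
    proof -
      have "\<bar>x / ?u\<bar> = \<bar>x\<bar> / ?u" using u by simp
      also have "\<dots> \<le> (\<phi> y * r * exp ((3 + ?c) * norm z)) / (\<phi> y * m)"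
      proof (rule frac_le)
        show "\<bar>x\<bar> \<le> \<phi> y * r * exp ((3 + ?c) * norm z)"
          using that(1,2) weaken[OF that(3)] phi_pos[of y]
          by (meson mult_left_mono mult_nonneg_nonneg less_imp_le order.trans)
        show "0 < \<phi> y * m" using m phi_pos[of y] by simp
      qed (use that phi_pos[of y] um in \<open>auto simp: less_imp_le\<close>)
      also have "\<dots> = r / m * exp ((3 + ?c) * norm z)"
        using phi_pos[of y] by simp
      finally show ?thesis .
    qed
    have "\<bar>?e - ?w / ?u\<bar> \<le> (if s = 0 then sqrt h else h / sqrt s) * (C0 + C1) * exp ((3 + ?c) * norm z)"
    proof (cases "s = 0")
      case True
      have sh: "h \<le> T" using True hs by simp
      define r where "r x = \<phi> (y + sqrt h *\<^sub>R x) - \<phi> y" for x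
      have [measurable]: "r \<in> borel_measurable borel" unfolding r_def[abs_def] by measurable
      have r_le: "norm (r x) \<le> \<phi> y * (sqrt h * L) * exp ((1 + ?c) * norm x)" for x
      proof -
        have le: "L * norm (sqrt h *\<^sub>R x) \<le> ?c * norm x"
          using h sh L_nonneg by (auto simp: mult.assoc intro!: mult_left_mono mult_right_mono)
        have "norm (r x) \<le> \<phi> y * (L * norm (sqrt h *\<^sub>R x) * exp (L * norm (sqrt h *\<^sub>R x)))"
          unfolding r_def real_norm_def by (rule phi_diff_le)
        also have "\<dots> = \<phi> y * (sqrt h * L) * (norm x * exp (L * norm (sqrt h *\<^sub>R x)))"
          using h by (simp add: mult_ac)
        also have "\<dots> \<le> \<phi> y * (sqrt h * L) * (exp (norm x) * exp (?c * norm x))"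
          using le h L_nonneg phi_pos[of y] real_le_exp[of "norm x"]
          by (intro mult_left_mono mult_mono) (auto simp: less_imp_le)
        also have "\<dots> = \<phi> y * (sqrt h * L) * exp ((1 + ?c) * norm x)"
          by (simp add: distrib_right exp_add)
        finally show ?thesis .
      qed
      have "?u - \<phi> y = (\<integral>x. r x \<partial>std_gauss)"
        using integrable_heat[OF dominated_phi _ sh, of y] h True
        by (simp add: r_def heat_def std_gauss.prob_space[simplified])
      then have "\<bar>?u - \<phi> y\<bar> \<le> \<phi> y * (sqrt h * L) * E1"
        using norm_integral_exp_dominated[OF _ r_le] by (simp add: E1_def)
      moreover have "?w = \<phi> y + r z" using True by (simp add: r_def)
      moreover note r_le[of z]
      ultimately have "\<bar>?w - ?u\<bar> \<le> \<phi> y * (sqrt h * L) * exp ((1 + ?c) * norm z) + \<phi> y * (sqrt h * L) * E1"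
        unfolding real_norm_def by linarith
      also have "\<dots> \<le> \<phi> y * (sqrt h * L) * exp ((1 + ?c) * norm z) + \<phi> y * (sqrt h * L) * E1 * exp ((1 + ?c) * norm z)"
      proof -
        have "\<phi> y * (sqrt h * L) * E1 * 1 \<le> \<phi> y * (sqrt h * L) * E1 * exp ((1 + ?c) * norm z)"
          using c h L_nonneg phi_pos[of y] E1 by (intro mult_left_mono) (auto simp: less_imp_le)
        then show ?thesis by simp
      qed
      also have "\<dots> = \<phi> y * (sqrt h * (L + L * E1)) * exp ((1 + ?c) * norm z)"
        by (simp add: algebra_simps)
      finally have "\<bar>(?w - ?u) / ?u\<bar> \<le> (sqrt h * (L + L * E1)) / m * exp ((3 + ?c) * norm z)"
        by (rule ratio) (use h L_nonneg E1 in auto)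
      moreover have "\<bar>?e - 1\<bar> \<le> (sqrt h * (2 * B)) * exp ((3 + ?c) * norm z)"
      proof -
        have "\<bar>?e - 1\<bar> \<le> 2 * norm k * exp (2 * norm z)"
          by (rule gauss_tilt_bounds(1)[OF k1])
        also have "\<dots> \<le> (sqrt h * (2 * B)) * exp ((3 + ?c) * norm z)"
        proof (rule mult_mono)
          show "2 * norm k \<le> sqrt h * (2 * B)" using kB by (simp add: mult_ac)
          show "exp (2 * norm z) \<le> exp ((3 + ?c) * norm z)" using c by (intro weaken) simp
        qed (use h B in auto)
        finally show ?thesis .
      qed
      moreover have "?e - ?w / ?u = (?e - 1) - (?w - ?u) / ?u"
        using u by (simp add: diff_divide_distrib)
      ultimately have "\<bar>?e - ?w / ?u\<bar> \<le> (sqrt h * (2 * B)) * exp ((3 + ?c) * norm z)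
          + (sqrt h * (L + L * E1)) / m * exp ((3 + ?c) * norm z)"
        by linarith
      also have "\<dots> = sqrt h * C0 * exp ((3 + ?c) * norm z)"
        using m by (simp add: C0_def field_simps)
      also have "\<dots> \<le> sqrt h * (C0 + C1) * exp ((3 + ?c) * norm z)"
        using h C0 C1 by (intro mult_right_mono mult_left_mono) auto
      finally show ?thesis using True by simp
    next
      case False
      then have s1: "0 < s" using s by simp
      have "sqrt h * (heat_grad (h + s) \<phi> y \<bullet> z) = ?u * (k \<bullet> z)"
        using u by (simp add: k_def drift_def)
      then have eq: "?w / ?u - 1 - k \<bullet> z = (?w - ?u - sqrt h * (heat_grad (h + s) \<phi> y \<bullet> z)) / ?u"
        using u by (simp add: diff_divide_distrib)
      have "\<bar>?w / ?u - 1 - k \<bullet> z\<bar> \<le> (h / sqrt s * C) / m * exp ((3 + ?c) * norm z)"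
        unfolding eq using expansion[OF h(1) s1 hs, of y z] by (rule ratio) (use h s C in auto)
      moreover have "\<bar>?e - 1 - k \<bullet> z\<bar> \<le> h / sqrt s * (3 * B\<^sup>2 * sqrt T) * exp ((3 + ?c) * norm z)"
      proof -
        have "(norm k)\<^sup>2 \<le> (sqrt h * B)\<^sup>2"
          using kB by (intro power_mono) auto
        also have "\<dots> = h * B\<^sup>2" using h by (simp add: power_mult_distrib)
        also have "\<dots> \<le> h / sqrt s * (B\<^sup>2 * sqrt T)"
        proof -
          have "h * B\<^sup>2 * 1 \<le> h * B\<^sup>2 * (sqrt T / sqrt s)"
            using h s1 hs by (intro mult_left_mono) auto
          then show ?thesis by (simp add: mult_ac)
        qed
        finally have k2: "(norm k)\<^sup>2 \<le> h / sqrt s * (B\<^sup>2 * sqrt T)" .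
        have "\<bar>?e - 1 - k \<bullet> z\<bar> \<le> 3 * (norm k)\<^sup>2 * exp (3 * norm z)"
          by (rule gauss_tilt_bounds(2)[OF k1])
        also have "\<dots> \<le> 3 * (h / sqrt s * (B\<^sup>2 * sqrt T)) * exp ((3 + ?c) * norm z)"
          using k2 h s1 c T_pos by (intro mult_mono weaken mult_left_mono) auto
        finally show ?thesis by (simp add: mult_ac)
      qed
      ultimately have "\<bar>?e - ?w / ?u\<bar> \<le> (h / sqrt s * C) / m * exp ((3 + ?c) * norm z) +
          h / sqrt s * (3 * B\<^sup>2 * sqrt T) * exp ((3 + ?c) * norm z)"
        by linarith
      also have "\<dots> = h / sqrt s * C1 * exp ((3 + ?c) * norm z)"
        by (simp add: C1_def algebra_simps)
      also have "\<dots> \<le> h / sqrt s * (C0 + C1) * exp ((3 + ?c) * norm z)"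
        using h s1 C0 C1 by (intro mult_right_mono mult_left_mono) auto
      finally show ?thesis using False by simp
    qed
    with k1 show ?thesis by (simp only: k_def)
  qed
  with C0 C1 eta show thesis by (intro that[of "C0 + C1" \<eta>]) auto
qed

text \<open>With the time \<open>s > 0\<close> left after the step, \<open>transform s g\<close> oscillates by \<open>sqrt h / sqrt s\<close> over the
  step and the densities differ by \<open>h / sqrt s\<close>, which gives the error \<open>sqrt h * (h / s)\<close>. In the last
  step \<open>g / \<phi>\<close> is merely bounded, but the densities differ only by \<open>sqrt h\<close>.\<close>

lemma euler_step_error:
  obtains C \<eta> where "C \<ge> 0" "\<eta> > 0"
    and "\<And>g h s y. dominated g \<Longrightarrow> 0 < h \<Longrightarrow> h \<le> \<eta> \<Longrightarrow> 0 \<le> s \<Longrightarrow> h + s \<le> T \<Longrightarrow>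
      \<bar>(\<integral>z. transform s g (y + h *\<^sub>R drift (h + s) y + sqrt h *\<^sub>R z) \<partial>std_gauss) - transform (h + s) g y\<bar>
        \<le> C * sqrt h * (if s = 0 then 1 else h / s)"
proof -
  let ?c = "L * sqrt T"
  obtain C \<eta> where C: "C \<ge> 0" and eta: "\<eta> > 0"
    and density: "\<And>h s y z. 0 < h \<Longrightarrow> h \<le> \<eta> \<Longrightarrow> 0 \<le> s \<Longrightarrow> h + s \<le> T \<Longrightarrow> norm (sqrt h *\<^sub>R drift (h + s) y) \<le> 1 \<and>
      \<bar>exp ((sqrt h *\<^sub>R drift (h + s) y) \<bullet> z - (norm (sqrt h *\<^sub>R drift (h + s) y))\<^sup>2 / 2)
          - heat s \<phi> (y + sqrt h *\<^sub>R z) / heat (h + s) \<phi> y\<bar>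
        \<le> (if s = 0 then sqrt h else h / sqrt s) * C * exp ((3 + ?c) * norm z)"
    using transition_density_diff_le by blast
  define K where "K = 2 + 4 * E TYPE('a) (2 + ?c) / E TYPE('a) (- ?c)"
  have K: "K \<ge> 0"
    using exp_moment_pos[where 'a='a, of "2 + ?c"] exp_moment_pos[where 'a='a, of "- ?c"] by (simp add: K_def)
  define C' where "C' = C * E TYPE('a) (3 + ?c) + K * C * E TYPE('a) (4 + ?c)"
  have e3: "0 < E TYPE('a) (3 + ?c)" and e4: "0 < E TYPE('a) (4 + ?c)" by (simp_all add: exp_moment_pos)
  have "\<bar>(\<integral>z. transform s g (y + h *\<^sub>R drift (h + s) y + sqrt h *\<^sub>R z) \<partial>std_gauss) - transform (h + s) g y\<bar>
        \<le> C' * sqrt h * (if s = 0 then 1 else h / s)"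
    if g: "dominated g" and h: "0 < h" "h \<le> \<eta>" and s: "0 \<le> s" and hs: "h + s \<le> T" for g h s y
  proof -
    note [measurable] = dominated_measurable[OF g] measurable_transform[OF g]
    have s0: "0 \<le> s" "s \<le> T" and hs0: "0 < h + s" "0 \<le> h + s" and h0: "0 \<le> h" "h \<le> T"
      using h s hs by auto
    define k where "k = sqrt h *\<^sub>R drift (h + s) y"
    have k1: "norm k \<le> 1" using density[OF h s hs] by (simp add: k_def)
    define e where "e z = exp (k \<bullet> z - (norm k)\<^sup>2 / 2)" for z
    define f where "f z = heat s \<phi> (y + sqrt h *\<^sub>R z) / heat (h + s) \<phi> y" for z
    define F where "F z = transform s g (y + sqrt h *\<^sub>R z)" for z
    have [measurable]: "F \<in> borel_measurable borel" unfolding F_def[abs_def] by measurable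
    have F1: "\<bar>F z\<bar> \<le> 1" for z unfolding F_def by (rule abs_transform_le[OF g s0])
    have u: "heat (h + s) \<phi> y > 0" by (rule heat_phi_pos[OF hs0(2) hs])
    have int_e: "integrable std_gauss e" "(\<integral>z. e z \<partial>std_gauss) = 1"
      unfolding e_def[abs_def] by (rule integrable_gauss_tilt[OF k1], rule integral_gauss_tilt[OF k1])
    have step: "heat h (heat s g') y = heat (h + s) g' y" if "dominated g'" for g'
    proof (cases "s = 0")
      case True
      then have "heat s g' = g'" by (simp add: fun_eq_iff)
      then show ?thesis using True by simp
    next
      case False
      then show ?thesis using heat_heat[OF that h(1) _ hs] s by simp
    qed
    have int_f: "integrable std_gauss f"
    proof (cases "s = 0")
      case True
      then show ?thesis
        unfolding f_def[abs_def] using integrable_heat[OF dominated_phi h0, of y] by simp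
    next
      case False
      then show ?thesis
        unfolding f_def[abs_def] using integrable_heat_phi_step[of s h y] h s hs by simp
    qed
    have one_f: "(\<integral>z. f z \<partial>std_gauss) = 1"
      using step[OF dominated_phi] u by (simp add: f_def heat_def[of h])
    have Fe: "(\<integral>z. transform s g (y + h *\<^sub>R drift (h + s) y + sqrt h *\<^sub>R z) \<partial>std_gauss) = (\<integral>z. F z * e z \<partial>std_gauss)"
    proof -
      have arg: "y + h *\<^sub>R drift (h + s) y + sqrt h *\<^sub>R z = y + sqrt h *\<^sub>R (z + k)" for z
        using h by (simp add: k_def algebra_simps)
      then show ?thesis
        unfolding arg using integral_std_gauss_shift[of F k] by (simp add: F_def e_def mult.commute)
    qed
    have Ff: "transform (h + s) g y = (\<integral>z. F z * f z \<partial>std_gauss)"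
    proof -
      have "F z * f z = heat s g (y + sqrt h *\<^sub>R z) / heat (h + s) \<phi> y" for z
        using heat_phi_pos[OF s0, of "y + sqrt h *\<^sub>R z"] by (simp add: F_def f_def transform_def)
      then show ?thesis
        using step[OF g] by (simp add: transform_def heat_def[of h])
    qed
    have ef: "\<bar>e z - f z\<bar> \<le> ((if s = 0 then sqrt h else h / sqrt s) * C) * exp ((3 + ?c) * norm z)" for z
      using density[OF h s hs, of y z] by (simp add: e_def f_def k_def)
    show ?thesis
    proof (cases "s = 0")
      case True
      have "\<bar>(\<integral>z. F z * e z \<partial>std_gauss) - (\<integral>z. F z * f z \<partial>std_gauss)\<bar> \<le> 1 * (sqrt h * C) * E TYPE('a) (0 + (3 + ?c))"
        by (rule weighted_integral_diff_le[where a = 0, OF _ F1 _ int_e int_f one_f]) (use F1 ef True in auto)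
      also have "\<dots> \<le> C' * sqrt h"
        using K C h e4 by (simp add: C'_def algebra_simps)
      finally show ?thesis unfolding Fe Ff using True by simp
    next
      case False
      then have s1: "0 < s" using s by simp
      have Fa: "\<bar>F z - F 0\<bar> \<le> (K * (sqrt h / sqrt s)) * exp (1 * norm z)" for z
      proof -
        have "\<bar>F z - F 0\<bar> \<le> K * (norm (sqrt h *\<^sub>R z) / sqrt s)"
          using heat_ratio_lipschitz[OF g s1 s0(2), of y "sqrt h *\<^sub>R z"] by (simp add: F_def transform_def K_def)
        also have "\<dots> = K * (sqrt h / sqrt s) * norm z" using h by simp
        also have "\<dots> \<le> K * (sqrt h / sqrt s) * exp (1 * norm z)"
          using K h s1 real_le_exp[of "norm z"] by (intro mult_left_mono) auto
        finally show ?thesis .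
      qed
      have "\<bar>(\<integral>z. F z * e z \<partial>std_gauss) - (\<integral>z. F z * f z \<partial>std_gauss)\<bar> \<le>
          (K * (sqrt h / sqrt s)) * (h / sqrt s * C) * E TYPE('a) (1 + (3 + ?c))"
        by (rule weighted_integral_diff_le[OF _ F1 Fa int_e int_f one_f]) (use ef False in auto)
      also have "\<dots> = (K * C * E TYPE('a) (4 + ?c)) * (sqrt h * (h / (sqrt s * sqrt s)))"
        by (simp add: mult_ac)
      also have "\<dots> = (K * C * E TYPE('a) (4 + ?c)) * (sqrt h * (h / s))"
        using s1 by simp
      also have "\<dots> \<le> C' * (sqrt h * (h / s))"
        using C e3 h s1 by (intro mult_right_mono) (auto simp: C'_def)
      finally show ?thesis unfolding Fe Ff using False by (simp add: mult.assoc)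
    qed
  qed
  moreover have "C' \<ge> 0" using C K e3 e4 by (simp add: C'_def)
  ultimately show thesis using eta by (intro that[of C' \<eta>]) auto
qed

end

section \<open>The Euler-Maruyama chain\<close>

lemma euler_maruyama_cong:
  assumes "\<And>j. 1 \<le> j \<Longrightarrow> j \<le> i \<Longrightarrow> W j \<omega> = W' j \<omega>'"
  shows "euler_maruyama b T n W i \<omega> = euler_maruyama b T n W' i \<omega>'"
  using assms by (induction i) auto

lemma measurable_euler_maruyama:
  fixes b :: "real \<Rightarrow> 'a::euclidean_space \<Rightarrow> 'a"
  assumes b: "\<And>i. i < n \<Longrightarrow> b (real i * T / real n) \<in> borel_measurable borel"
    and W: "\<And>j. 1 \<le> j \<Longrightarrow> j \<le> i \<Longrightarrow> W j \<in> borel_measurable N" and i: "i \<le> n"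
  shows "euler_maruyama b T n W i \<in> borel_measurable N"
  using W i
proof (induction i)
  case 0
  then show ?case by (simp add: fun_eq_iff[THEN iffD2] measurable_const)
next
  case (Suc i)
  have [measurable]: "euler_maruyama b T n W i \<in> borel_measurable N"
    using Suc by simp
  have [measurable]: "W (Suc i) \<in> borel_measurable N" "b (real i * T / real n) \<in> borel_measurable borel"
    using Suc.prems b by simp_all
  show ?case
    unfolding euler_maruyama.simps(2)[abs_def] by measurable
qed

context prob_space begin

text \<open>The scheme can be run on the coordinate functions of the product space \<open>PiM {1..i}\<close>; this exhibits
  its state after \<open>i\<close> steps as a measurable function of the first \<open>i\<close> increments.\<close>

lemma indep_euler_maruyama:
  fixes b :: "real \<Rightarrow> 'b::euclidean_space \<Rightarrow> 'b"
  assumes b: "\<And>i. i < n \<Longrightarrow> b (real i * T / real n) \<in> borel_measurable borel"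
    and W: "indep_vars (\<lambda>_. borel) W {1..n}" and i: "Suc i \<le> n"
  shows "indep_var borel (euler_maruyama b T n W i) borel (W (Suc i))"
proof -
  let ?A = "{1..i}" and ?B = "{Suc i}"
  let ?G = "\<lambda>x. euler_maruyama b T n (\<lambda>j y. y j) i x"
  have "indep_var (PiM ?A (\<lambda>_. borel)) (\<lambda>\<omega>. restrict (\<lambda>j. W j \<omega>) ?A) (PiM ?B (\<lambda>_. borel)) (\<lambda>\<omega>. restrict (\<lambda>j. W j \<omega>) ?B)"
    using i by (intro indep_var_restrict[OF W]) auto
  moreover have "?G \<in> borel_measurable (PiM ?A (\<lambda>_. borel))"
    using i by (intro measurable_euler_maruyama b measurable_component_singleton) auto
  moreover have "(\<lambda>x. x (Suc i)) \<in> borel_measurable (PiM ?B (\<lambda>_. borel :: 'b measure))"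
    by (intro measurable_component_singleton) simp
  ultimately have "indep_var borel (?G \<circ> (\<lambda>\<omega>. restrict (\<lambda>j. W j \<omega>) ?A)) borel ((\<lambda>x. x (Suc i)) \<circ> (\<lambda>\<omega>. restrict (\<lambda>j. W j \<omega>) ?B))"
    by (rule indep_var_compose)
  moreover have "?G \<circ> (\<lambda>\<omega>. restrict (\<lambda>j. W j \<omega>) ?A) = euler_maruyama b T n W i"
    by (auto simp: fun_eq_iff intro!: euler_maruyama_cong)
  moreover have "(\<lambda>x. x (Suc i)) \<circ> (\<lambda>\<omega>. restrict (\<lambda>j. W j \<omega>) ?B) = W (Suc i)"
    by (simp add: fun_eq_iff)
  ultimately show ?thesis by simp
qed

lemma expectation_indep_gauss:
  fixes G :: "'b::euclidean_space \<times> 'b \<Rightarrow> real"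
  assumes ind: "indep_var borel X borel W" and W: "distr M borel W = std_gauss"
    and [measurable]: "G \<in> borel_measurable borel" and G: "\<And>p. \<bar>G p\<bar> \<le> c"
  shows "expectation (\<lambda>\<omega>. G (X \<omega>, W \<omega>)) = expectation (\<lambda>\<omega>. \<integral>z. G (X \<omega>, z) \<partial>std_gauss)"
proof -
  have [measurable]: "X \<in> borel_measurable M" "W \<in> borel_measurable M"
    using ind by (auto simp: indep_var_distribution_eq)
  have joint: "distr M borel X \<Otimes>\<^sub>M std_gauss = distr M (borel \<Otimes>\<^sub>M borel) (\<lambda>\<omega>. (X \<omega>, W \<omega>))"
    using ind W by (simp add: indep_var_distribution_eq)
  interpret X: prob_space "distr M borel X" by (rule prob_space_distr) simp
  interpret XW: pair_prob_space "distr M borel X" "std_gauss :: 'b measure" by standard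
  have [measurable]: "G \<in> borel_measurable (borel \<Otimes>\<^sub>M borel)" by (simp add: borel_prod)
  have int: "integrable (distr M borel X \<Otimes>\<^sub>M std_gauss) G"
    using G by (intro XW.P.integrable_const_bound[of _ c]) auto
  have "expectation (\<lambda>\<omega>. G (X \<omega>, W \<omega>)) = (\<integral>p. G p \<partial>(distr M borel X \<Otimes>\<^sub>M std_gauss))"
    unfolding joint by (subst integral_distr) simp_all
  also have "\<dots> = (\<integral>x. \<integral>z. G (x, z) \<partial>std_gauss \<partial>distr M borel X)"
    using XW.integral_fst'[OF int] by simp
  also have "\<dots> = expectation (\<lambda>\<omega>. \<integral>z. G (X \<omega>, z) \<partial>std_gauss)"
    by (subst integral_distr) simp_all
  finally show ?thesis .
qed

end

text \<open>The profile of the one-step errors, where \<open>j\<close> steps are left and \<open>j = 0\<close> is the last step.\<close>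

lemma sum_inverse_le_ln:
  assumes "n \<ge> 1"
  shows "(\<Sum>j\<le>n. if j = 0 then 1 else 1 / real j) \<le> 2 + ln (real n)"
  using assms
proof (induction n rule: dec_induct)
  case base
  show ?case by simp
next
  case (step n)
  have n: "real n > 0" using step by simp
  have "ln (real n / real (Suc n)) \<le> real n / real (Suc n) - 1"
    using n by (intro ln_le_minus_one) simp
  also have "\<dots> = - (1 / real (Suc n))" by (simp add: field_simps)
  finally have "1 / real (Suc n) \<le> ln (real (Suc n)) - ln (real n)"
    using n by (simp add: ln_div)
  then show ?case using step.IH by simp
qed

context log_lipschitz begin

text \<open>The expectations of \<open>transform (T - t) g\<close> at the states of the chain at the times \<open>t\<close> interpolate
  between \<open>transform T g 0\<close> and the expectation of \<open>g / \<phi>\<close> at the final state. When \<open>j > 0\<close> steps are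
  left, the remaining time is \<open>s = j * h\<close>, and the error of the step is at most \<open>C * sqrt h / j\<close>.\<close>

lemma euler_maruyama_error:
  obtains C \<eta> where "C \<ge> 0" "\<eta> > 0"
    and "\<And>(M :: 'w measure) n W b g. prob_space M \<Longrightarrow> n \<ge> 1 \<Longrightarrow> T / real n \<le> \<eta> \<Longrightarrow> dominated g \<Longrightarrow>
      prob_space.indep_vars M (\<lambda>_. borel) W {1..n} \<Longrightarrow>
      (\<And>i. i \<in> {1..n} \<Longrightarrow> distr M borel (W i) = std_gauss) \<Longrightarrow>
      (\<And>t. 0 \<le> t \<Longrightarrow> t < T \<Longrightarrow> b t = drift (T - t)) \<Longrightarrow>
      \<bar>(\<integral>\<omega>. g (euler_maruyama b T n W n \<omega>) / \<phi> (euler_maruyama b T n W n \<omega>) \<partial>M) - heat T g 0 / heat T \<phi> 0\<bar>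
        \<le> C * sqrt (T / real n) * (2 + ln (real n))"
proof -
  obtain C \<eta> where C: "C \<ge> 0" and eta: "\<eta> > 0"
    and step: "\<And>g h s y. dominated g \<Longrightarrow> 0 < h \<Longrightarrow> h \<le> \<eta> \<Longrightarrow> 0 \<le> s \<Longrightarrow> h + s \<le> T \<Longrightarrow>
      \<bar>(\<integral>z. transform s g (y + h *\<^sub>R drift (h + s) y + sqrt h *\<^sub>R z) \<partial>std_gauss) - transform (h + s) g y\<bar>
        \<le> C * sqrt h * (if s = 0 then 1 else h / s)"
    using euler_step_error by blast
  have "\<bar>(\<integral>\<omega>. g (euler_maruyama b T n W n \<omega>) / \<phi> (euler_maruyama b T n W n \<omega>) \<partial>M) - heat T g 0 / heat T \<phi> 0\<bar>
        \<le> C * sqrt (T / real n) * (2 + ln (real n))"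
    if M: "prob_space M" and n: "n \<ge> 1" and h_le: "T / real n \<le> \<eta>" and g: "dominated g"
      and ind: "prob_space.indep_vars M (\<lambda>_. borel) W {1..n}"
      and W: "\<And>i. i \<in> {1..n} \<Longrightarrow> distr M borel (W i) = std_gauss"
      and b: "\<And>t. 0 \<le> t \<Longrightarrow> t < T \<Longrightarrow> b t = drift (T - t)" for M :: "'w measure" and n W b g
  proof -
    interpret M: prob_space M by (rule M)
    note [measurable] = measurable_transform[OF g]
    define h where "h = T / real n"
    have h: "0 < h" "h \<le> \<eta>" using h_le T_pos n by (simp_all add: h_def)
    \<comment> \<open>\<open>R i\<close> is the time that remains after \<open>i\<close> steps.\<close>
    define R where "R i = real (n - i) * h" for i
    have R0: "R 0 = T" using n by (simp add: R_def h_def)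
    have Rn: "R n = 0" by (simp add: R_def)
    have R_Suc: "h + R (Suc i) = R i" if "i < n" for i
      using that by (simp add: R_def of_nat_diff Suc_diff_Suc algebra_simps)
    have R_le: "R i \<le> T" "0 \<le> R i" for i
      using h n T_pos by (simp_all add: R_def h_def field_simps)
    have b_eq: "b (real i * T / real n) = drift (R i)" if "i < n" for i
    proof -
      have "real i * T / real n < T" using that T_pos by (simp add: field_simps)
      moreover have "T - real i * T / real n = R i"
        using that n by (simp add: R_def h_def of_nat_diff field_simps)
      ultimately show ?thesis using b[of "real i * T / real n"] T_pos by simp
    qed
    let ?Y = "euler_maruyama b T n W"
    have W_meas: "W j \<in> borel_measurable M" if "j \<in> {1..n}" for j
      using ind that by (auto simp: M.indep_vars_def)
    have b_meas: "b (real i * T / real n) \<in> borel_measurable borel" if "i < n" for i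
      unfolding b_eq[OF that] by simp
    have Y_meas: "?Y i \<in> borel_measurable M" if "i \<le> n" for i
      using that by (intro measurable_euler_maruyama b_meas W_meas) auto
    define a where "a i = (\<integral>\<omega>. transform (R i) g (?Y i \<omega>) \<partial>M)" for i
    have diff: "\<bar>a (Suc i) - a i\<bar> \<le> C * sqrt h * (if n - Suc i = 0 then 1 else 1 / real (n - Suc i))" if i: "i < n" for i
    proof -
      note [measurable] = Y_meas[OF less_imp_le[OF i]]
      let ?x = "\<lambda>y. y + h *\<^sub>R drift (R i) y"
      define J where "J y = (\<integral>z. transform (R (Suc i)) g (?x y + sqrt h *\<^sub>R z) \<partial>std_gauss)" for y
      have [measurable]: "J \<in> borel_measurable borel" unfolding J_def[abs_def] by measurable
      have tr1: "\<bar>transform (R j) g y\<bar> \<le> 1" for j y by (intro abs_transform_le g R_le)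
      have J1: "\<bar>J y\<bar> \<le> 1" for y
      proof -
        have "norm (J y) \<le> 1 * exp_moment TYPE('a) 0"
          unfolding J_def by (rule norm_integral_exp_dominated) (simp_all add: tr1)
        then show ?thesis by (simp add: exp_moment_def std_gauss.prob_space[simplified])
      qed
      have "a (Suc i) = M.expectation (\<lambda>\<omega>. (\<lambda>(y, z). transform (R (Suc i)) g (?x y + sqrt h *\<^sub>R z)) (?Y i \<omega>, W (Suc i) \<omega>))"
        unfolding a_def using b_eq[OF i] by (simp add: h_def)
      also have "\<dots> = M.expectation (\<lambda>\<omega>. J (?Y i \<omega>))"
      proof (subst M.expectation_indep_gauss[where c = 1])
        show "M.indep_var borel (?Y i) borel (W (Suc i))"
          using i by (intro M.indep_euler_maruyama b_meas ind) auto
        show "distr M borel (W (Suc i)) = std_gauss" using i by (intro W) auto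
        show "(\<lambda>(y, z). transform (R (Suc i)) g (?x y + sqrt h *\<^sub>R z)) \<in> borel_measurable borel"
          unfolding borel_prod[symmetric] by measurable
      qed (auto simp: tr1 J_def)
      finally have "a (Suc i) - a i = M.expectation (\<lambda>\<omega>. J (?Y i \<omega>) - transform (R i) g (?Y i \<omega>))"
        unfolding a_def using J1 tr1
        by (subst Bochner_Integration.integral_diff) (auto intro!: M.integrable_const_bound[of _ 1])
      moreover have "norm (M.expectation (\<lambda>\<omega>. J (?Y i \<omega>) - transform (R i) g (?Y i \<omega>))) \<le>
          C * sqrt h * (if n - Suc i = 0 then 1 else 1 / real (n - Suc i))" (is "_ \<le> ?c")
      proof (rule order.trans[OF integral_norm_bound], rule M.integral_le_const)
        show "integrable M (\<lambda>\<omega>. norm (J (?Y i \<omega>) - transform (R i) g (?Y i \<omega>)))"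
          using J1 tr1
          by (intro integrable_norm Bochner_Integration.integrable_diff M.integrable_const_bound[of _ 1]) auto
        show "AE \<omega> in M. norm (J (?Y i \<omega>) - transform (R i) g (?Y i \<omega>)) \<le> ?c"
        proof (rule AE_I2)
          fix \<omega>
          have "\<bar>J (?Y i \<omega>) - transform (R i) g (?Y i \<omega>)\<bar> \<le> C * sqrt h * (if R (Suc i) = 0 then 1 else h / R (Suc i))"
            using step[OF g h R_le(2), of "Suc i" "?Y i \<omega>"] R_le(1)[of i] unfolding R_Suc[OF i] J_def by simp
          then show "norm (J (?Y i \<omega>) - transform (R i) g (?Y i \<omega>)) \<le> ?c"
            using h by (simp add: R_def split: if_splits)
        qed
      qed
      ultimately show ?thesis by simp
    qed
    have "\<bar>a n - a 0\<bar> = \<bar>\<Sum>i<n. a (Suc i) - a i\<bar>"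
      by (simp add: sum_lessThan_telescope)
    also have "\<dots> \<le> (\<Sum>i<n. \<bar>a (Suc i) - a i\<bar>)"
      by (rule sum_abs)
    also have "\<dots> \<le> (\<Sum>i<n. C * sqrt h * (if n - Suc i = 0 then 1 else 1 / real (n - Suc i)))"
      by (intro sum_mono diff) simp
    also have "\<dots> = C * sqrt h * (\<Sum>j<n. if j = 0 then 1 else 1 / real j)"
      unfolding sum_distrib_left[symmetric]
      by (subst sum.nat_diff_reindex[where g = "\<lambda>j. if j = 0 then 1 else 1 / real j"]) simp
    also have "\<dots> \<le> C * sqrt h * (2 + ln (real n))"
    proof (rule mult_left_mono)
      have "(\<Sum>j<n. if j = 0 then 1 else 1 / real j) \<le> (\<Sum>j\<le>n. if j = 0 then 1 else 1 / real j)"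
        by (intro sum_mono2) auto
      then show "(\<Sum>j<n. if j = 0 then 1 else 1 / real j) \<le> 2 + ln (real n)"
        using sum_inverse_le_ln[OF n] by linarith
    qed (use C h in simp)
    finally show ?thesis
      by (simp add: a_def R0 Rn transform_def h_def M.prob_space)
  qed
  with C eta show thesis by (intro that[of C \<eta>]) auto
qed

end

section \<open>The Schroedinger-Foellmer drift and the limit\<close>

lemma distr_std_gauss_scale:
  fixes y :: "'a::euclidean_space"
  assumes s: "s > 0"
  shows "distr std_gauss borel (\<lambda>z. y + sqrt s *\<^sub>R z) = density lborel (\<lambda>x. ennreal (heat_kernel s y x))"
proof (rule measure_eqI)
  fix A :: "'a set"
  assume "A \<in> sets (distr std_gauss borel (\<lambda>z. y + sqrt s *\<^sub>R z))"
  then have [measurable]: "A \<in> sets borel" by simp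
  have "emeasure (distr std_gauss borel (\<lambda>z. y + sqrt s *\<^sub>R z)) A =
      (\<integral>\<^sup>+z. indicator A (y + sqrt s *\<^sub>R z) \<partial>std_gauss)"
    using nn_integral_distr[of "\<lambda>z. y + sqrt s *\<^sub>R z" std_gauss borel "indicator A"] by simp
  also have "\<dots> = emeasure (density lborel (\<lambda>x. ennreal (heat_kernel s y x))) A"
    using s by (subst nn_integral_std_gauss_scale) (simp_all add: emeasure_density)
  finally show "emeasure (distr std_gauss borel (\<lambda>z. y + sqrt s *\<^sub>R z)) A =
      emeasure (density lborel (\<lambda>x. ennreal (heat_kernel s y x))) A" .
qed simp

text \<open>The Gaussian density cancels against the denominator of \<open>phi\<close>. This is where the target measure
  enters: the heat semigroup, run for the time \<open>T\<close> from \<open>0\<close>, turns \<open>f * phi\<close> into an integral against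
  it.\<close>

lemma heat_phi_mult:
  fixes f \<rho> :: "'a::euclidean_space \<Rightarrow> real"
  assumes T: "T > 0" and [measurable]: "f \<in> borel_measurable borel" "\<rho> \<in> borel_measurable borel"
    and \<rho>: "\<And>y. \<rho> y \<ge> 0"
  shows "heat T (\<lambda>y. f y * phi T \<rho> y) 0 = (\<integral>y. f y \<partial>density lborel (\<lambda>y. ennreal (\<rho> y)))"
proof -
  have [measurable]: "phi T \<rho> \<in> borel_measurable borel"
    unfolding phi_def[abs_def] by measurable
  have "heat T (\<lambda>y. f y * phi T \<rho> y) 0 = (\<integral>y. f y * phi T \<rho> y \<partial>distr std_gauss borel (\<lambda>z. 0 + sqrt T *\<^sub>R z))"
    unfolding heat_def by (subst integral_distr) simp_all
  also have "\<dots> = (\<integral>y. heat_kernel T 0 y *\<^sub>R (f y * phi T \<rho> y) \<partial>lborel)"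
    unfolding distr_std_gauss_scale[OF T] by (subst integral_density) simp_all
  also have "\<dots> = (\<integral>y. \<rho> y *\<^sub>R f y \<partial>lborel)"
    using heat_kernel_pos[OF T, of "0::'a"]
    by (intro Bochner_Integration.integral_cong) (auto simp: phi_def less_imp_neq[THEN not_sym])
  also have "\<dots> = (\<integral>y. f y \<partial>density lborel (\<lambda>y. ennreal (\<rho> y)))"
    using \<rho> by (subst integral_density) simp_all
  finally show ?thesis .
qed

lemma log_lipschitz_phi:
  fixes \<rho> :: "'a::euclidean_space \<Rightarrow> real"
  assumes T: "T > 0" and \<rho>: "\<And>y. \<rho> y > 0" and [measurable]: "\<rho> \<in> borel_measurable borel"
    and L: "L-lipschitz_on UNIV (\<lambda>y. ln (phi T \<rho> y))"
  shows "log_lipschitz (phi T \<rho>) L T"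
proof
  show pos: "phi T \<rho> y > 0" for y
    using heat_kernel_pos[OF T, of 0 y] \<rho>[of y] by (simp add: phi_def)
  show "phi T \<rho> (y + k) \<le> phi T \<rho> y * exp (L * norm k)" for y k
  proof -
    have "ln (phi T \<rho> (y + k)) \<le> ln (phi T \<rho> y) + L * norm k"
      using lipschitz_onD[OF L, of "y + k" y] by (simp add: dist_norm)
    then have "exp (ln (phi T \<rho> (y + k))) \<le> exp (ln (phi T \<rho> y) + L * norm k)"
      by simp
    then show ?thesis using pos by (simp add: exp_add)
  qed
  show "phi T \<rho> \<in> borel_measurable borel"
    unfolding phi_def[abs_def] by measurable
  show "L \<ge> 0" using L by (rule lipschitz_on_nonneg)
qed (rule T)

lemma (in log_lipschitz) sf_drift_eq_drift:
  assumes Z: "std_normal_vector M Z" and \<phi>: "\<phi> = phi T \<rho>" and t: "0 \<le> t" "t < T"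
  shows "sf_drift M Z T \<rho> t = drift (T - t)"
proof
  fix y
  note [measurable] = std_normal_vector_distr(1)[OF Z]
  have s: "0 < T - t" "T - t \<le> T" using t by simp_all
  have "(\<integral>\<omega>. phi T \<rho> (y + sqrt (T - t) *\<^sub>R Z \<omega>) \<partial>M) = heat (T - t) \<phi> y" for y
    unfolding heat_def std_normal_vector_distr(2)[OF Z, symmetric] \<phi>[symmetric]
    by (subst integral_distr) simp_all
  then have "sf_drift M Z T \<rho> t y = grad (\<lambda>y. ln (heat (T - t) \<phi> y)) y"
    by (simp add: sf_drift_def)
  also have "\<dots> = heat_grad (T - t) \<phi> y /\<^sub>R heat (T - t) \<phi> y"
    using grad_ln[OF GDERIV_heat[OF dominated_phi s]] grad_eq[OF GDERIV_heat[OF dominated_phi s]]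
      heat_phi_pos[of "T - t" y] s by simp
  finally show "sf_drift M Z T \<rho> t y = drift (T - t) y" by (simp only: drift_def)
qed

theorem theorem2p1:
  fixes M :: "'w measure"
    and T :: real
    and \<mu> :: "(real ^ 'd) measure"
    and \<rho> :: "real ^ 'd \<Rightarrow> real"
    and Z :: "nat \<Rightarrow> nat \<Rightarrow> 'w \<Rightarrow> real ^ 'd"
    and Z\<^sub>0 :: "'w \<Rightarrow> real ^ 'd"
  assumes "prob_space M" and "complete_measure M" and "atomless M"
    and "T > 0"
    and "prob_space \<mu>"
    and "\<rho> \<in> borel_measurable borel"
    and "\<mu> = density lborel (\<lambda>y. ennreal (\<rho> y))"
    and "\<And>y. \<rho> y > 0"
    and "integrable lborel (\<lambda>y. \<rho> y * ((norm y)\<^sup>2 + ln (\<rho> y)))"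
    and "\<exists>L. L-lipschitz_on UNIV (\<lambda>y. ln (phi T \<rho> y))"
    and "std_normal_vector M Z\<^sub>0"
    and "\<And>n i. n \<ge> 1 \<Longrightarrow> i \<in> {1..n} \<Longrightarrow> std_normal_vector M (Z n i)"
    and "\<And>n. n \<ge> 1 \<Longrightarrow> prob_space.indep_vars M (\<lambda>_. borel) (Z n) {1..n}"
  shows "weakly_converges
           (\<lambda>n. distr M borel (euler_maruyama (sf_drift M Z\<^sub>0 T \<rho>) T n (Z n) n)) \<mu>"
proof -
  obtain L where L: "L-lipschitz_on UNIV (\<lambda>y. ln (phi T \<rho> y))"
    using assms(10) by blast
  interpret log_lipschitz "phi T \<rho>" L T
    using assms(4,8,6) L by (rule log_lipschitz_phi)
  obtain C \<eta> where C: "C \<ge> 0" and eta: "\<eta> > 0"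
    and error: "\<And>(M :: 'w measure) n W b g. prob_space M \<Longrightarrow> n \<ge> 1 \<Longrightarrow> T / real n \<le> \<eta> \<Longrightarrow> dominated g \<Longrightarrow>
      prob_space.indep_vars M (\<lambda>_. borel) W {1..n} \<Longrightarrow>
      (\<And>i. i \<in> {1..n} \<Longrightarrow> distr M borel (W i) = std_gauss) \<Longrightarrow>
      (\<And>t. 0 \<le> t \<Longrightarrow> t < T \<Longrightarrow> b t = drift (T - t)) \<Longrightarrow>
      \<bar>(\<integral>\<omega>. g (euler_maruyama b T n W n \<omega>) / phi T \<rho> (euler_maruyama b T n W n \<omega>) \<partial>M) - heat T g 0 / heat T (phi T \<rho>) 0\<bar>
        \<le> C * sqrt (T / real n) * (2 + ln (real n))"
    using euler_maruyama_error[where 'w = 'w] by blast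
  let ?b = "sf_drift M Z\<^sub>0 T \<rho>"
  let ?Y = "\<lambda>n. euler_maruyama ?b T n (Z n) n"
  have drift: "?b t = drift (T - t)" if "0 \<le> t" "t < T" for t
    using assms(11) that by (intro sf_drift_eq_drift) auto
  have rho0: "\<rho> y \<ge> 0" for y using assms(8)[of y] by simp
  have Y_meas: "?Y n \<in> borel_measurable M" for n
  proof (rule measurable_euler_maruyama)
    fix i assume i: "i < n"
    then have "real i * T / real n < T" using T_pos by (simp add: field_simps)
    then show "?b (real i * T / real n) \<in> borel_measurable borel"
      using T_pos by (subst drift) simp_all
  next
    fix j assume "1 \<le> j" "j \<le> n"
    then show "Z n j \<in> borel_measurable M"
      using assms(12)[of n j] by (intro std_normal_vector_distr(1)) auto
  qed simp
  show ?thesis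
    unfolding weakly_converges_def
  proof (intro allI impI)
    fix f :: "real ^ 'd \<Rightarrow> real"
    assume f: "continuous_on UNIV f \<and> bounded (range f)"
    then have [measurable]: "f \<in> borel_measurable borel"
      by (intro borel_measurable_continuous_onI) simp
    obtain c where c: "c > 0" and fc: "\<And>x. \<bar>f x\<bar> \<le> c"
      using f unfolding bounded_pos by auto
    \<comment> \<open>Dividing by the bound \<open>c\<close> of \<open>f\<close> makes \<open>g\<close> dominated.\<close>
    define g where "g y = f y / c * phi T \<rho> y" for y
    have g: "dominated g"
      unfolding dominated_def g_def[abs_def]
      using c fc phi_pos by (auto simp: abs_mult divide_le_eq less_imp_le mult_left_le_one_le intro!: mult_left_le_one_le)
    have target: "heat T g 0 / heat T (phi T \<rho>) 0 = (\<integral>x. f x \<partial>\<mu>) / c"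
    proof -
      have "heat T g 0 = (\<integral>x. f x / c \<partial>\<mu>)"
        unfolding g_def[abs_def] assms(7) using assms(4,6) rho0 by (intro heat_phi_mult) simp_all
      moreover have "heat T (phi T \<rho>) 0 = 1"
        using heat_phi_mult[OF assms(4) _ assms(6) rho0, of "\<lambda>_. 1"] prob_space.prob_space[OF assms(5)]
        by (simp add: assms(7))
      ultimately show ?thesis by simp
    qed
    have bound: "\<bar>(\<integral>x. f x \<partial>distr M borel (?Y n)) - (\<integral>x. f x \<partial>\<mu>)\<bar> \<le> c * (C * sqrt (T / real n) * (2 + ln (real n)))"
      if n: "n \<ge> 1" "T / real n \<le> \<eta>" for n
    proof -
      have "\<bar>(\<integral>\<omega>. g (?Y n \<omega>) / phi T \<rho> (?Y n \<omega>) \<partial>M) - heat T g 0 / heat T (phi T \<rho>) 0\<bar>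
        \<le> C * sqrt (T / real n) * (2 + ln (real n))"
      proof (rule error[OF assms(1) n g assms(13)[OF n(1)]])
        show "distr M borel (Z n i) = std_gauss" if "i \<in> {1..n}" for i
          using assms(12)[OF n(1) that] by (rule std_normal_vector_distr(2))
      qed (rule drift)
      moreover have "(\<integral>\<omega>. g (?Y n \<omega>) / phi T \<rho> (?Y n \<omega>) \<partial>M) = (\<integral>x. f x \<partial>distr M borel (?Y n)) / c"
      proof -
        have "phi T \<rho> x \<noteq> 0" for x using phi_pos[of x] by simp
        then show ?thesis using Y_meas[of n] by (simp add: g_def integral_distr)
      qed
      ultimately have "\<bar>((\<integral>x. f x \<partial>distr M borel (?Y n)) - (\<integral>x. f x \<partial>\<mu>)) / c\<bar> \<le> C * sqrt (T / real n) * (2 + ln (real n))"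
        unfolding target by (simp only: diff_divide_distrib)
      then show ?thesis using c by (simp add: divide_le_eq mult.commute)
    qed
    have "(\<lambda>n. T / real n) \<longlonglongrightarrow> 0" by real_asymp
    then have "eventually (\<lambda>n. T / real n < \<eta>) sequentially"
      using eta by (rule order_tendstoD(2))
    then have ev: "eventually (\<lambda>n. \<bar>(\<integral>x. f x \<partial>distr M borel (?Y n)) - (\<integral>x. f x \<partial>\<mu>)\<bar> \<le>
        c * (C * sqrt (T / real n) * (2 + ln (real n)))) sequentially"
      using eventually_ge_at_top[of 1] by eventually_elim (intro bound, auto)
    have "(\<lambda>n. sqrt (T / real n) * (2 + ln (real n))) \<longlonglongrightarrow> 0"
      using T_pos by real_asymp
    then have "(\<lambda>n. c * C * (sqrt (T / real n) * (2 + ln (real n)))) \<longlonglongrightarrow> c * C * 0"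
      by (rule tendsto_mult_left)
    then have "(\<lambda>n. c * (C * sqrt (T / real n) * (2 + ln (real n)))) \<longlonglongrightarrow> 0"
      by (simp only: mult.assoc mult_zero_right)
    with ev have "(\<lambda>n. (\<integral>x. f x \<partial>distr M borel (?Y n)) - (\<integral>x. f x \<partial>\<mu>)) \<longlonglongrightarrow> 0"
      unfolding real_norm_def[symmetric] by (rule Lim_null_comparison)
    then show "(\<lambda>n. \<integral>x. f x \<partial>distr M borel (?Y n)) \<longlonglongrightarrow> (\<integral>x. f x \<partial>\<mu>)"
      by (rule LIM_zero_cancel)
  qed
qed

end
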